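(* Let $d\ge2$, $N\ge2$ be integers. For every $p\in[0,1]$ there exists $\beta=\beta(p)$ with $1\le\beta\le d$ such that $$\mathbb P_p\big(\mathcal C^c=\emptyset\ \text{ or }\ \dim_{\mathcal H}(\mathcal C^c)=\beta\big)=1,$$ where $\mathcal C^c$ is the union of the connected components larger than one point of the limiting set $\mathcal C$ of fractal percolation in $[0,1]^d$ with parameters $N,p$.
   Context: Fractal percolation. For integers $d\ge2$, $N\ge 2$, a level-$n$ cube ($n\ge1$) is a cube $D^n_{\mathbf k}=\prod_{j=1}^d\left[\frac{k_j-1}{N^n},\frac{k_j}{N^n}\right]$ with $\mathbf k=(k_1,\dots,k_d)\in\{1,\dots,N^n\}^d$. Let $D$ be the set of all cubes of all levels $n\ge1$, $\Omega=\{0,1\}^D$, and let $\mathbb P_p$ be the product measure on $\Omega$ under which $\omega(D^n_{\mathbf k})=1$ with probability $p\in[0,1]$, independently for all cubes. Let $\mathcal C^n\subset[0,1]^d$ be the union of all level-$n$ cubes $Q$ such that $\omega=1$ for $Q$ and for each of the cubes of levels $1,\dots,n-1$ containing $Q$; the limiting set is $\mathcal C=\bigcap_{n\ge1}\mathcal C^n$. For $x\in\mathcal C$ let $\mathcal C_x$ be the connected component of $x$ in $\mathcal C$; $\mathcal C^c=\{x\in\mathcal C:\mathcal C_x\ne\{x\}\}$. $\dim_{\mathcal H}$ denotes Hausdorff dimension. *)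

theory Defs
  imports "HOL-Probability.Probability"
begin

section \<open>Hausdorff measure and Hausdorff dimension\<close>

text \<open>
  The summand \<open>(diam U)\<^sup>s\<close>, with the usual conventions that the empty set contributes \<open>0\<close>
  and that \<open>(diam U)\<^sup>0 = 1\<close> for nonempty \<open>U\<close> (note that \<open>0 powr 0 = 0\<close> in HOL).
\<close>
definition diam_pow :: "real \<Rightarrow> 'a::metric_space set \<Rightarrow> ennreal" where
  "diam_pow s U = (if U = {} then 0 else if s = 0 then 1 else ennreal (diameter U powr s))"

text \<open>Boundedness is required explicitly since \<^const>\<open>diameter\<close> is meaningless on unbounded sets.\<close>
definition hausdorff_premeasure :: "real \<Rightarrow> real \<Rightarrow> 'a::metric_space set \<Rightarrow> ennreal" where
  "hausdorff_premeasure s \<delta> A =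
     (INF U \<in> {U :: nat \<Rightarrow> 'a set. A \<subseteq> (\<Union>i. U i) \<and> (\<forall>i. bounded (U i) \<and> diameter (U i) \<le> \<delta>)}.
        \<Sum>i. diam_pow s (U i))"

definition hausdorff_measure :: "real \<Rightarrow> 'a::metric_space set \<Rightarrow> ennreal" where
  "hausdorff_measure s A = (SUP \<delta> \<in> {0<..}. hausdorff_premeasure s \<delta> A)"

definition hausdorff_dim :: "'a::metric_space set \<Rightarrow> ereal" where
  "hausdorff_dim A = Inf (ereal ` {s. 0 \<le> s \<and> hausdorff_measure s A = 0})"

section \<open>Fractal percolation\<close>

definition level_cube :: "nat \<Rightarrow> nat \<Rightarrow> nat ^ 'd \<Rightarrow> (real ^ 'd::finite) set" where
  "level_cube N n k =
     cbox (\<chi> j. (real (k $ j) - 1) / real N ^ n) (\<chi> j. real (k $ j) / real N ^ n)"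

definition level_cubes :: "nat \<Rightarrow> nat \<Rightarrow> (real ^ 'd::finite) set set" where
  "level_cubes N n = level_cube N n ` {k. \<forall>j. k $ j \<in> {1..N ^ n}}"

definition all_cubes :: "nat \<Rightarrow> (real ^ 'd::finite) set set" where
  "all_cubes N = (\<Union>n\<in>{1..}. level_cubes N n)"

text \<open>
  Configurations are indexed by the cubes themselves, as subsets of \<open>\<real>\<^sup>d\<close>.  For \<open>N \<ge> 2\<close> a cube
  determines its level and its index vector, so distinct pairs \<open>(n, k)\<close> carry independent marks.
  The marks \<open>1\<close> and \<open>0\<close> are rendered as \<^const>\<open>True\<close> and \<^const>\<open>False\<close>.
\<close>
definition percolation_measure :: "nat \<Rightarrow> real \<Rightarrow> ((real ^ 'd::finite) set \<Rightarrow> bool) measure" where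
  "percolation_measure N p = PiM (all_cubes N) (\<lambda>_. measure_pmf (bernoulli_pmf p))"

definition retained :: "nat \<Rightarrow> ((real ^ 'd::finite) set \<Rightarrow> bool) \<Rightarrow> nat \<Rightarrow> (real ^ 'd) set" where
  "retained N \<omega> n =
     \<Union> {Q \<in> level_cubes N n. \<omega> Q \<and> (\<forall>m\<in>{1..<n}. \<forall>R\<in>level_cubes N m. Q \<subseteq> R \<longrightarrow> \<omega> R)}"

definition limit_set :: "nat \<Rightarrow> ((real ^ 'd::finite) set \<Rightarrow> bool) \<Rightarrow> (real ^ 'd) set" where
  "limit_set N \<omega> = (\<Inter>n\<in>{1..}. retained N \<omega> n)"

definition nontrivial_components :: "'a::topological_space set \<Rightarrow> 'a set" where
  "nontrivial_components C = {x \<in> C. connected_component_set C x \<noteq> {x}}"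

end

theory Submission imports Defs begin

text \<open>
  Write \<open>C\<^sup>c\<close> for the union of the nontrivial components of the limit set, and let \<open>G\<close> be the event
  that \<open>C\<^sup>c\<close> is null for \<open>s\<close>-dimensional Hausdorff measure.  A retained cube of level \<open>n\<close> contains a
  scaled copy of the whole process, independent of the levels up to \<open>n\<close>, and \<open>G\<close> is inherited by
  these copies.  Hence \<open>G\<close> together with at least \<open>m\<close> retained cubes of level \<open>n\<close> has probability at
  most \<open>P(G)\<^sup>m\<close>.  If \<open>C\<^sup>c\<close> is nonempty, the limit set is infinite, so the number of retained cubes tends
  to infinity; thus either \<open>P(G) = 1\<close> or \<open>G\<close> almost surely fails whenever \<open>C\<^sup>c\<close> is nonempty.  The
  critical \<open>s\<close> is \<open>\<beta>\<close>.

  This requires \<open>G\<close> to be measurable.  The set \<open>C\<^sup>c\<close> is a countable union of sets \<open>E\<^sub>e\<close> of points whose component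
  contains two points at distance at least \<open>e\<close>.  Each \<open>E\<^sub>e\<close> is the decreasing intersection of the
  corresponding compact sets for the finite level approximations, so an open cover of \<open>E\<^sub>e\<close> already
  covers one of these, and the latter depend on finitely many marks only.
\<close>

section \<open>Hausdorff content\<close>

text \<open>This is the premeasure without the bound on the mesh. For s > 0 it has the same null
  sets as Hausdorff measure, and a bound \<open>< e\<close> on it is witnessed by one single
  cover.\<close>

definition hausdorff_content :: "real \<Rightarrow> 'a::metric_space set \<Rightarrow> ennreal" where
  "hausdorff_content s A =
     (INF U \<in> {U :: nat \<Rightarrow> 'a set. A \<subseteq> (\<Union>i. U i) \<and> (\<forall>i. bounded (U i))}. \<Sum>i. diam_pow s (U i))"

lemma ennreal_eq_0I:
  assumes "\<And>e. e > 0 \<Longrightarrow> x \<le> ennreal e"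
  shows "x = 0"
proof -
  have "x \<le> 0 + ennreal e" if "e > 0" for e using assms[OF that] by simp
  then have "x \<le> 0" by (rule ennreal_le_epsilon)
  then show ?thesis by simp
qed

lemma diam_pow_pos: "s > 0 \<Longrightarrow> diam_pow s U = ennreal (diameter U powr s)"
  by (simp add: diam_pow_def)

lemma hausdorff_content_less_iff:
  "hausdorff_content s A < e \<longleftrightarrow>
     (\<exists>U. A \<subseteq> (\<Union>i. U i) \<and> (\<forall>i. bounded (U i)) \<and> (\<Sum>i. diam_pow s (U i)) < e)"
  by (auto simp: hausdorff_content_def INF_less_iff)

lemma hausdorff_content_le:
  assumes "A \<subseteq> (\<Union>i. U i)" "\<And>i. bounded (U i)"
  shows "hausdorff_content s A \<le> (\<Sum>i. diam_pow s (U i))"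
  unfolding hausdorff_content_def using assms by (intro INF_lower) auto

lemma hausdorff_content_mono: "A \<subseteq> B \<Longrightarrow> hausdorff_content s A \<le> hausdorff_content s B"
  unfolding hausdorff_content_def by (intro INF_superset_mono) auto

lemma hausdorff_content_le_finite:
  fixes F :: "'a::metric_space set set"
  assumes F: "finite F" "A \<subseteq> \<Union>F" "\<And>U. U \<in> F \<Longrightarrow> bounded U" and s: "s > 0"
  shows "hausdorff_content s A \<le> (\<Sum>U\<in>F. diam_pow s U)"
proof -
  obtain h where h: "bij_betw h {..<card F} F"
    using ex_bij_betw_nat_finite[OF F(1)] by (auto simp: atLeast0LessThan)
  \<comment> \<open>The finite family is padded by empty sets, which cost 0 by the convention in
    \<open>diam_pow\<close>.\<close>
  define V where "V i = (if i < card F then h i else {})" for i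
  have "A \<subseteq> (\<Union>i. V i)"
  proof
    fix x assume "x \<in> A"
    with F obtain U where U: "U \<in> F" "x \<in> U" by auto
    with h have "U \<in> h ` {..<card F}" by (simp add: bij_betw_def)
    then obtain i where "i < card F" "h i = U" by auto
    with U show "x \<in> (\<Union>i. V i)" by (auto simp: V_def intro!: exI[of _ i])
  qed
  moreover have "bounded (V i)" for i
    using F(3) bij_betwE[OF h] by (auto simp: V_def)
  ultimately have "hausdorff_content s A \<le> (\<Sum>i. diam_pow s (V i))"
    by (rule hausdorff_content_le)
  also have "\<dots> = (\<Sum>i<card F. diam_pow s (V i))"
    by (rule suminf_finite) (auto simp: V_def diam_pow_def)
  also have "\<dots> = (\<Sum>U\<in>F. diam_pow s U)"
    by (rule trans[OF _ sum.reindex_bij_betw[OF h]]) (simp add: V_def)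
  finally show ?thesis .
qed

section \<open>Null sets of content and of measure; change of exponent\<close>

lemma hausdorff_content_le_measure:
  "hausdorff_content s A \<le> hausdorff_measure s A"
proof -
  have "hausdorff_content s A \<le> hausdorff_premeasure s 1 A"
    unfolding hausdorff_content_def hausdorff_premeasure_def by (intro INF_superset_mono) auto
  also have "\<dots> \<le> hausdorff_measure s A"
    unfolding hausdorff_measure_def by (intro SUP_upper) auto
  finally show ?thesis .
qed

text \<open>For s > 0, a cover of small total cost consists of sets of small diameter, so it
  automatically obeys any prescribed mesh bound.\<close>

lemma hausdorff_measure_eq_0_iff:
  assumes s: "s > 0"
  shows "hausdorff_measure s A = 0 \<longleftrightarrow> hausdorff_content s A = 0"
proof
  assume "hausdorff_measure s A = 0"
  then show "hausdorff_content s A = 0"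
    using hausdorff_content_le_measure[of s A] by simp
next
  assume c: "hausdorff_content s A = 0"
  have "hausdorff_premeasure s \<delta> A = 0" if \<delta>: "\<delta> > 0" for \<delta>
  proof -
    have "hausdorff_premeasure s \<delta> A \<le> ennreal e" if e: "e > 0" for e
    proof -
      \<comment> \<open>The bound e controls the total cost; the bound
        \<open>\<delta> powr s\<close> forces every single diameter to be at most \<delta>.\<close>
      have "hausdorff_content s A < ennreal (min e (\<delta> powr s))"
        using c e \<delta> by simp
      then obtain U where U: "A \<subseteq> (\<Union>i. U i)" "\<And>i. bounded (U i)"
        and less: "(\<Sum>i. diam_pow s (U i)) < ennreal (min e (\<delta> powr s))"
        unfolding hausdorff_content_less_iff by blast
      have "diameter (U i) \<le> \<delta>" for i
      proof -
        have "ennreal (diameter (U i) powr s) < ennreal (min e (\<delta> powr s))"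
          using ennreal_suminf_lessD[OF less, of i] s by (simp add: diam_pow_pos)
        then have "diameter (U i) powr s < \<delta> powr s"
          by (subst (asm) ennreal_less_iff) auto
        then show ?thesis
          using s \<delta> powr_mono2[of s \<delta> "diameter (U i)"] by linarith
      qed
      with U have "hausdorff_premeasure s \<delta> A \<le> (\<Sum>i. diam_pow s (U i))"
        unfolding hausdorff_premeasure_def by (intro INF_lower) auto
      also have "\<dots> \<le> ennreal e"
        using less by (meson ennreal_leI less_imp_le min.cobounded1 order_trans)
      finally show ?thesis .
    qed
    then show ?thesis by (rule ennreal_eq_0I)
  qed
  then show "hausdorff_measure s A = 0"
    unfolding hausdorff_measure_def by auto
qed

lemma hausdorff_measure_eq_0_mono:
  assumes A: "hausdorff_measure s A = 0" and s: "0 \<le> s" "s < t"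
  shows "hausdorff_measure t A = 0"
proof -
  have "hausdorff_premeasure s 1 A = 0"
    using A unfolding hausdorff_measure_def by (auto simp: SUP_eq_iff bot_ennreal)
  moreover have "hausdorff_content t A \<le> hausdorff_premeasure s 1 A"
    unfolding hausdorff_premeasure_def
  proof (rule INF_greatest)
    fix U :: "nat \<Rightarrow> 'a set"
    assume U: "U \<in> {U. A \<subseteq> (\<Union>i. U i) \<and> (\<forall>i. bounded (U i) \<and> diameter (U i) \<le> 1)}"
    then have "hausdorff_content t A \<le> (\<Sum>i. diam_pow t (U i))"
      by (intro hausdorff_content_le) auto
    also have "\<dots> \<le> (\<Sum>i. diam_pow s (U i))"
    proof (intro suminf_le)
      fix i
      have d: "0 \<le> diameter (U i)" "diameter (U i) \<le> 1" using U diameter_ge_0 by auto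
      have "diameter (U i) powr t \<le> diameter (U i) powr s" using d s by (intro powr_mono') auto
      \<comment> \<open>This bound serves the case s = 0, where every nonempty set costs exactly
        1.\<close>
      moreover have "diameter (U i) powr t \<le> 1" using d s powr_mono2[of t "diameter (U i)" 1] by auto
      ultimately show "diam_pow t (U i) \<le> diam_pow s (U i)"
        using s by (auto simp: diam_pow_def ennreal_leI simp flip: ennreal_1)
    qed auto
    finally show "hausdorff_content t A \<le> (\<Sum>i. diam_pow s (U i))" .
  qed
  ultimately show ?thesis using s by (simp add: hausdorff_measure_eq_0_iff)
qed

section \<open>Countable unions and Lipschitz images of null sets\<close>

lemma suminf_ennreal_half_powers:
  assumes "r \<ge> 0" shows "(\<Sum>i. ennreal (r * (1/2) ^ Suc i)) = ennreal r"
proof -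
  have "(\<lambda>i. r * (1/2) ^ Suc i) sums (r * 1)"
    by (intro sums_mult power_half_series)
  then show ?thesis using assms by (intro suminf_ennreal_eq) auto
qed

lemma hausdorff_content_UN_eq_0:
  fixes A :: "nat \<Rightarrow> 'a::metric_space set"
  assumes "\<And>j. hausdorff_content s (A j) = 0"
  shows "hausdorff_content s (\<Union>j. A j) = 0"
proof -
  have "hausdorff_content s (\<Union>j. A j) \<le> ennreal e" if e: "e > 0" for e
  proof -
    have "\<exists>U. A j \<subseteq> (\<Union>i. U i) \<and> (\<forall>i. bounded (U i)) \<and>
        (\<Sum>i. diam_pow s (U i)) < ennreal (e * (1/2) ^ Suc j)" for j
      using assms[of j] e unfolding hausdorff_content_less_iff[symmetric] by simp
    then obtain U where U: "\<And>j. A j \<subseteq> (\<Union>i. U j i)" "\<And>j i. bounded (U j i)"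
      "\<And>j. (\<Sum>i. diam_pow s (U j i)) < ennreal (e * (1/2) ^ Suc j)" by metis
    define V where "V n = case_prod U (prod_decode n)" for n
    have "(\<Union>j. A j) \<subseteq> (\<Union>n. V n)"
    proof
      fix x assume "x \<in> (\<Union>j. A j)"
      then obtain j i where "x \<in> U j i" using U(1) by blast
      then have "x \<in> V (prod_encode (j, i))" by (simp add: V_def)
      then show "x \<in> (\<Union>n. V n)" by blast
    qed
    moreover have "bounded (V n)" for n by (simp add: V_def U(2) split: prod.split)
    ultimately have "hausdorff_content s (\<Union>j. A j) \<le> (\<Sum>n. diam_pow s (V n))"
      by (rule hausdorff_content_le)
    also have "\<dots> = (\<Sum>n. (\<lambda>(j, i). diam_pow s (U j i)) (prod_decode n))"
      by (simp add: V_def split_beta)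
    also have "\<dots> = (\<Sum>j. \<Sum>i. diam_pow s (U j i))"
      by (rule suminf_ennreal_2dimen) simp
    also have "\<dots> \<le> (\<Sum>j. ennreal (e * (1/2) ^ Suc j))"
      using U(3) by (intro suminf_le) (auto intro: less_imp_le)
    also have "\<dots> = ennreal e" using e by (intro suminf_ennreal_half_powers) auto
    finally show ?thesis .
  qed
  then show ?thesis by (rule ennreal_eq_0I)
qed

lemma hausdorff_content_lipschitz_eq_0:
  fixes f :: "'a::metric_space \<Rightarrow> 'b::real_normed_vector"
  assumes f: "L-lipschitz_on UNIV f" and A: "hausdorff_content s A = 0" and s: "s > 0"
  shows "hausdorff_content s (f ` A) = 0"
proof -
  have L: "L \<ge> 0" using f by (rule lipschitz_on_nonneg)
  have "hausdorff_content s (f ` A) \<le> ennreal e" if e: "e > 0" for e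
  proof -
    \<comment> \<open>Images of the covering sets cost at most \<open>L powr s\<close> times as
      much; the summand 1 keeps the denominator positive when L = 0.\<close>
    define e' where "e' = e / (L powr s + 1)"
    have e': "e' > 0" using e by (simp add: e'_def add_nonneg_pos)
    then have "hausdorff_content s A < ennreal e'" using A by simp
    then obtain U where U: "A \<subseteq> (\<Union>i. U i)" "\<And>i. bounded (U i)"
      and less: "(\<Sum>i. diam_pow s (U i)) < ennreal e'"
      unfolding hausdorff_content_less_iff by blast
    have bd: "dist (f x) (f y) \<le> L * diameter (U i)" if "x \<in> U i" "y \<in> U i" for x y i
    proof -
      have "dist (f x) (f y) \<le> L * dist x y" using lipschitz_onD[OF f] by auto
      also have "\<dots> \<le> L * diameter (U i)"
        using that U(2) L by (intro mult_left_mono diameter_bounded_bound)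
      finally show ?thesis .
    qed
    have diam: "diameter (f ` U i) \<le> L * diameter (U i)" for i
      using L U(2)[of i] bd by (intro diameter_le) (auto simp: dist_norm diameter_ge_0)
    have bounded: "bounded (f ` U i)" for i
    proof (cases "U i = {}")
      case False
      then obtain x where "x \<in> U i" by auto
      then show ?thesis using bd[of x i] by (auto simp: bounded_def intro!: exI[of _ "f x"])
    qed simp
    have "f ` A \<subseteq> (\<Union>i. f ` U i)" using U(1) unfolding image_UN[symmetric] by (rule image_mono)
    then have "hausdorff_content s (f ` A) \<le> (\<Sum>i. diam_pow s (f ` U i))"
      using bounded by (rule hausdorff_content_le)
    also have "\<dots> \<le> (\<Sum>i. ennreal (L powr s) * diam_pow s (U i))"
    proof (intro suminf_le)
      fix i
      have "diameter (f ` U i) powr s \<le> (L * diameter (U i)) powr s"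
        using diam diameter_ge_0[OF bounded] s by (intro powr_mono2) auto
      also have "\<dots> = L powr s * diameter (U i) powr s"
        by (rule powr_mult)
      finally show "diam_pow s (f ` U i) \<le> ennreal (L powr s) * diam_pow s (U i)"
        using s by (simp add: diam_pow_pos ennreal_leI flip: ennreal_mult)
    qed auto
    also have "\<dots> \<le> ennreal (L powr s) * ennreal e'"
      using less by (simp add: mult_left_mono less_imp_le)
    also have "\<dots> \<le> ennreal e"
      using e by (simp add: e'_def divide_simps add_nonneg_pos ennreal_leI flip: ennreal_mult)
    finally show ?thesis .
  qed
  then show ?thesis by (rule ennreal_eq_0I)
qed

section \<open>Open covers of almost the same cost\<close>

lemma open_superset_diameter_powr:
  fixes U :: "'a::real_normed_vector set"
  assumes U: "bounded U" and s: "s > 0" and \<eta>: "\<eta> > 0"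
  shows "\<exists>V. U \<subseteq> V \<and> open V \<and> bounded V \<and> diameter V powr s \<le> diameter U powr s + \<eta>"
proof -
  \<comment> \<open>D is the diameter whose s-th power is exactly the permitted cost. It exceeds
    \<open>diameter U\<close>, and a neighbourhood of U of radius half the gap still has diameter at
    most D.\<close>
  define D where "D = (diameter U powr s + \<eta>) powr (1/s)"
  have Dpowr: "D powr s = diameter U powr s + \<eta>"
    unfolding D_def using s \<eta> by (simp add: powr_powr add_nonneg_pos)
  have D: "D \<ge> 0" by (simp add: D_def)
  have "diameter U < D"
  proof (rule ccontr)
    assume "\<not> diameter U < D"
    then have "D powr s \<le> diameter U powr s" using D s by (intro powr_mono2) auto
    with Dpowr \<eta> show False by simp
  qed
  define \<rho> where "\<rho> = (D - diameter U) / 2"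
  have \<rho>: "\<rho> > 0" using \<open>diameter U < D\<close> by (simp add: \<rho>_def)
  define V where "V = (\<Union>u\<in>U. ball u \<rho>)"
  have VD: "dist x y \<le> D" if "x \<in> V" "y \<in> V" for x y
  proof -
    from that obtain u v where uv: "u \<in> U" "v \<in> U" "dist u x < \<rho>" "dist v y < \<rho>"
      by (auto simp: V_def)
    have "dist u v \<le> diameter U" using uv U by (intro diameter_bounded_bound)
    moreover have "dist x y \<le> dist u x + dist u v + dist v y"
      using dist_triangle[of x y u] dist_triangle[of u y v] by (simp add: dist_commute)
    ultimately show ?thesis using uv by (simp add: \<rho>_def)
  qed
  have "diameter V \<le> D" using VD D by (intro diameter_le) (auto simp: dist_norm)
  moreover have bV: "bounded V"
  proof (cases "V = {}")
    case False
    then obtain x where "x \<in> V" by auto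
    then show ?thesis using VD[of x] by (auto simp: bounded_def)
  qed simp
  ultimately have "diameter V powr s \<le> D powr s"
    using s by (intro powr_mono2) (auto simp: diameter_ge_0)
  moreover have "open V" "U \<subseteq> V" using \<rho> by (auto simp: V_def)
  ultimately show ?thesis using bV Dpowr by auto
qed

text \<open>The slack below e is spread geometrically over the covering sets, each of which is
  enlarged to an open set. Openness is what later allows compactness to pass to a finite
  level.\<close>

lemma hausdorff_content_less_open_cover:
  fixes A :: "'a::real_normed_vector set"
  assumes A: "hausdorff_content s A < e" and s: "s > 0"
  obtains V where "A \<subseteq> V" "open V" "hausdorff_content s V < e"
proof -
  obtain U where U: "A \<subseteq> (\<Union>i. U i)" "\<And>i. bounded (U i)" and less: "(\<Sum>i. diam_pow s (U i)) < e"
    using A unfolding hausdorff_content_less_iff by blast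
  \<comment> \<open>The value e may be infinite, so the slack r is measured up to an intermediate,
    hence finite, value e'.\<close>
  obtain r where r: "r > 0" "(\<Sum>i. diam_pow s (U i)) + ennreal r < e"
  proof -
    obtain e' where e': "(\<Sum>i. diam_pow s (U i)) < e'" "e' < e" using less dense by blast
    define S where "S = (\<Sum>i. diam_pow s (U i))"
    have fin: "S < top" "e' < top" using e' top.not_eq_extremum by (auto simp: S_def intro: less_trans)
    have "enn2real S < enn2real e'"
      using e' fin by (simp add: S_def enn2real_less_iff)
    moreover have "S + ennreal (enn2real e' - enn2real S) = e'"
      using fin calculation by (cases S; cases e') (auto simp flip: ennreal_plus)
    ultimately show thesis using that[of "enn2real e' - enn2real S"] e' by (simp add: S_def)
  qed
  have "\<exists>V. U i \<subseteq> V \<and> open V \<and> bounded V \<and>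
      diameter V powr s \<le> diameter (U i) powr s + r * (1/2) ^ Suc i" for i
    using U(2) s r by (intro open_superset_diameter_powr) auto
  then obtain V where V: "\<And>i. U i \<subseteq> V i" "\<And>i. open (V i)" "\<And>i. bounded (V i)"
    "\<And>i. diameter (V i) powr s \<le> diameter (U i) powr s + r * (1/2) ^ Suc i" by metis
  have "(\<Sum>i. diam_pow s (V i)) \<le> (\<Sum>i. diam_pow s (U i) + ennreal (r * (1/2) ^ Suc i))"
  proof (intro suminf_le)
    fix i
    show "diam_pow s (V i) \<le> diam_pow s (U i) + ennreal (r * (1/2) ^ Suc i)"
      using V(4)[of i] s r by (simp add: diam_pow_pos ennreal_leI flip: ennreal_plus)
  qed auto
  also have "\<dots> = (\<Sum>i. diam_pow s (U i)) + (\<Sum>i. ennreal (r * (1/2) ^ Suc i))"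
    by (rule suminf_add[symmetric]) (rule summableI)+
  also have "(\<Sum>i. ennreal (r * (1/2) ^ Suc i)) = ennreal r"
    using r by (intro suminf_ennreal_half_powers) simp
  finally have "(\<Sum>i. diam_pow s (V i)) < e" using r by simp
  then have "hausdorff_content s (\<Union>i. V i) < e"
    using V(3) hausdorff_content_le[of "\<Union>i. V i" V s] by auto
  moreover have "A \<subseteq> (\<Union>i. V i)" using U(1) V(1) by fastforce
  moreover have "open (\<Union>i. V i)" using V(2) by auto
  ultimately show thesis by (intro that)
qed

text \<open>The distance from y is a 1-Lipschitz function that maps K onto a superset of
  [0, \<open>dist y z\<close>]. A cover of K thus yields intervals covering this segment, whose
  total length cannot be too small.\<close>

lemma hausdorff_content_1_connected:
  assumes K: "connected K" "y \<in> K" "z \<in> K" "y \<noteq> z"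
  shows "hausdorff_content 1 K \<noteq> 0"
proof
  assume 0: "hausdorff_content 1 K = 0"
  define D where "D = dist y z"
  have D: "D > 0" using K by (simp add: D_def)
  then have "hausdorff_content 1 K < ennreal (D / 2)" using 0 by simp
  then obtain U where U: "K \<subseteq> (\<Union>i. U i)" "\<And>i. bounded (U i)"
    and less: "(\<Sum>i. diam_pow 1 (U i)) < ennreal (D / 2)"
    unfolding hausdorff_content_less_iff by blast
  \<comment> \<open>A centre for each nonempty U i; for an empty one the choice is irrelevant. The
    interval J i has length twice the diameter of U i, which explains the threshold D / 2.\<close>
  define u where "u i = (SOME x. x \<in> U i)" for i
  define J where "J i = {dist y (u i) - diameter (U i) .. dist y (u i) + diameter (U i)}" for i
  have J: "dist y x \<in> J i" if "x \<in> U i" for x i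
  proof -
    have "u i \<in> U i" using that unfolding u_def by (rule someI)
    then have "dist x (u i) \<le> diameter (U i)" using that U by (intro diameter_bounded_bound)
    then show ?thesis
      using dist_triangle[of y x "u i"] dist_triangle[of y "u i" x] by (simp add: J_def dist_commute)
  qed
  have "{0..D} \<subseteq> (\<lambda>x. dist y x) ` K"
  proof -
    have "connected ((\<lambda>x. dist y x) ` K)"
      using K by (intro connected_continuous_image continuous_intros)
    moreover have "0 \<in> (\<lambda>x. dist y x) ` K" using K by (auto simp: image_iff intro!: bexI[of _ y])
    moreover have "D \<in> (\<lambda>x. dist y x) ` K" using K by (auto simp: D_def)
    ultimately show ?thesis by (intro connected_contains_Icc)
  qed
  also have "\<dots> \<subseteq> (\<Union>i. J i)" using U J by blast
  finally have "emeasure lborel {0..D} \<le> emeasure lborel (\<Union>i. J i)"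
    by (intro emeasure_mono) (auto simp: J_def)
  also have "\<dots> \<le> (\<Sum>i. emeasure lborel (J i))"
    by (intro emeasure_subadditive_countably) (auto simp: J_def)
  also have "\<dots> = (\<Sum>i. 2 * diam_pow 1 (U i))"
    using U by (intro suminf_cong)
      (simp add: J_def diam_pow_pos diameter_ge_0 ennreal_mult'' flip: ennreal_numeral)
  also have "\<dots> < ennreal D"
  proof -
    have "2 * (\<Sum>i. diam_pow 1 (U i)) < 2 * ennreal (D / 2)"
      using less by (intro ennreal_mult_strict_left_mono) auto
    also have "\<dots> = ennreal D" using D by (simp flip: ennreal_numeral ennreal_mult)
    finally show ?thesis by simp
  qed
  finally show False using D by simp
qed

section \<open>The cubes of the percolation process\<close>

text \<open>Cubes are indexed from \<open>0\<close> here, so that ancestors are obtained by integer division.\<close>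

definition cell :: "nat \<Rightarrow> nat \<Rightarrow> nat ^ 'd \<Rightarrow> (real ^ 'd::finite) set" where
  "cell N n k = level_cube N n (\<chi> j. Suc (k $ j))"

definition cell_indices :: "nat \<Rightarrow> nat \<Rightarrow> (nat ^ 'd::finite) set" where
  "cell_indices N n = {k. \<forall>j. k $ j < N ^ n}"

definition ancestor :: "nat \<Rightarrow> nat \<Rightarrow> nat ^ 'd \<Rightarrow> nat ^ 'd::finite" where
  "ancestor N m k = (\<chi> j. k $ j div N ^ m)"

text \<open>In base N, the m digits of each coordinate of l are appended to those of k, while
  \<open>ancestor\<close> deletes the last m digits.\<close>

definition descendant :: "nat \<Rightarrow> nat ^ 'd \<Rightarrow> nat \<Rightarrow> nat ^ 'd \<Rightarrow> nat ^ 'd::finite" where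
  "descendant N k m l = (\<chi> j. k $ j * N ^ m + l $ j)"

text \<open>The similarity of ratio N^(-n) that carries the unit cube onto
  \<open>cell N n k\<close>; \<open>unzoom\<close> is its inverse.\<close>

definition zoom :: "nat \<Rightarrow> nat \<Rightarrow> nat ^ 'd \<Rightarrow> real ^ 'd \<Rightarrow> real ^ 'd::finite" where
  "zoom N n k x = (\<chi> j. (real (k $ j) + x $ j) / real N ^ n)"

definition unzoom :: "nat \<Rightarrow> nat \<Rightarrow> nat ^ 'd \<Rightarrow> real ^ 'd \<Rightarrow> real ^ 'd::finite" where
  "unzoom N n k y = (\<chi> j. real N ^ n * y $ j - real (k $ j))"

section \<open>Cells and the arithmetic of their indices\<close>

lemma cell_eq_cbox:
  "cell N n k = cbox (\<chi> j. real (k $ j) / real N ^ n) (\<chi> j. (real (k $ j) + 1) / real N ^ n)"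
  by (simp add: cell_def level_cube_def add.commute)

lemma mem_cell:
  assumes "N \<ge> 1"
  shows "x \<in> cell N n k \<longleftrightarrow> (\<forall>j. real (k $ j) \<le> real N ^ n * x $ j \<and> real N ^ n * x $ j \<le> real (k $ j) + 1)"
  using assms by (simp add: cell_eq_cbox mem_box_cart field_simps)

lemma cell_nonempty: "cell N n k \<noteq> {}"
  by (auto simp: cell_eq_cbox interval_ne_empty_cart divide_right_mono)

lemma compact_cell: "compact (cell N n k)"
  and connected_cell: "connected (cell N n k)"
  by (auto simp: cell_eq_cbox convex_connected)

lemma level_cubes_eq: "level_cubes N n = cell N n ` cell_indices N n"
proof (intro equalityI subsetI)
  fix Q :: "(real ^ 'd) set" assume "Q \<in> level_cubes N n"
  then obtain k where k: "Q = level_cube N n k" "\<And>j. k $ j \<in> {1..N ^ n}"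
    by (auto simp: level_cubes_def)
  have "Suc (k $ j - 1) = k $ j" for j using k(2)[of j] by auto
  then have "(\<chi> j. Suc (k $ j - 1)) = k" by (simp add: vec_eq_iff)
  then have "Q = cell N n (\<chi> j. k $ j - 1)" using k(1) by (simp add: cell_def)
  moreover have "k $ j - 1 < N ^ n" for j using k(2)[of j] by auto
  ultimately show "Q \<in> cell N n ` cell_indices N n" by (auto simp: cell_indices_def)
next
  fix Q :: "(real ^ 'd) set" assume "Q \<in> cell N n ` cell_indices N n"
  then obtain k where "Q = cell N n k" "\<And>j. k $ j < N ^ n" by (auto simp: cell_indices_def)
  then show "Q \<in> level_cubes N n"
    by (auto simp: level_cubes_def cell_def Suc_le_eq intro!: imageI)
qed

lemma all_cubes_eq: "all_cubes N = (\<Union>n\<in>{1..}. cell N n ` cell_indices N n)"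
  by (simp add: all_cubes_def level_cubes_eq)

lemma finite_cell_indices: "finite (cell_indices N n :: (nat ^ 'd::finite) set)"
  and card_cell_indices: "card (cell_indices N n :: (nat ^ 'd::finite) set) \<le> (N ^ n) ^ CARD('d)"
proof -
  have eq: "(cell_indices N n :: (nat ^ 'd) set) = vec_lambda ` (Pi\<^sub>E UNIV (\<lambda>_. {..<N ^ n}))"
    by (force simp: cell_indices_def image_iff intro!: bexI[of _ "vec_nth _"])
  show "finite (cell_indices N n :: (nat ^ 'd) set)"
    unfolding eq by (intro finite_imageI finite_PiE) auto
  show "card (cell_indices N n :: (nat ^ 'd) set) \<le> (N ^ n) ^ CARD('d)"
    unfolding eq by (rule order_trans[OF card_image_le]) (auto simp: card_PiE intro!: finite_PiE)
qed

lemma ancestor_in_cell_indices: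
  assumes "k \<in> cell_indices N (n + m)"
  shows "ancestor N m k \<in> cell_indices N n"
  using assms by (auto simp: cell_indices_def ancestor_def power_add less_mult_imp_div_less)

lemma ancestor_ancestor: "ancestor N m (ancestor N m' k) = ancestor N (m' + m) k"
  by (simp add: ancestor_def vec_eq_iff power_add div_mult2_eq)

lemma ancestor_0 [simp]: "ancestor N 0 k = k"
  by (simp add: ancestor_def vec_eq_iff)

lemma descendant_in_cell_indices:
  assumes "k \<in> cell_indices N n" "l \<in> cell_indices N m"
  shows "descendant N k m l \<in> cell_indices N (n + m)"
  unfolding cell_indices_def descendant_def
proof (clarsimp)
  fix j
  have "k $ j + 1 \<le> N ^ n" "l $ j < N ^ m" using assms by (auto simp: cell_indices_def Suc_le_eq)
  then have "(k $ j + 1) * N ^ m \<le> N ^ n * N ^ m" by (intro mult_right_mono) auto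
  with \<open>l $ j < N ^ m\<close> show "k $ j * N ^ m + l $ j < N ^ (n + m)"
    by (simp add: power_add algebra_simps)
qed

text \<open>Only digits coming from l are deleted here, as N^(m - i) divides the contribution of k.
  In \<open>ancestor_descendant_ge\<close> all digits of l go and the deletion continues into
  k.\<close>

lemma ancestor_descendant_le:
  assumes "N \<ge> 1" "i \<le> m"
  shows "ancestor N (m - i) (descendant N k m l) = descendant N k i (ancestor N (m - i) l)"
  unfolding vec_eq_iff
proof
  fix j
  have "N ^ (m - i) > 0" using assms by auto
  moreover have "k $ j * N ^ m = (k $ j * N ^ i) * N ^ (m - i)"
    using assms by (simp flip: power_add)
  ultimately have "(k $ j * N ^ m + l $ j) div N ^ (m - i) = k $ j * N ^ i + l $ j div N ^ (m - i)"
    by (simp only: div_mult_self3)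
  then show "ancestor N (m - i) (descendant N k m l) $ j =
      descendant N k i (ancestor N (m - i) l) $ j"
    by (simp add: ancestor_def descendant_def)
qed

lemma ancestor_descendant:
  assumes "l \<in> cell_indices N m"
  shows "ancestor N m (descendant N k m l) = k"
  using assms by (auto simp: ancestor_def descendant_def vec_eq_iff cell_indices_def)
    (metis add.right_neutral div_less div_mult_self3 less_nat_zero_code)

lemma ancestor_descendant_ge:
  assumes "l \<in> cell_indices N m"
  shows "ancestor N (m + i) (descendant N k m l) = ancestor N i k"
  using assms by (simp add: ancestor_descendant flip: ancestor_ancestor)

text \<open>After clearing denominators, containment of the boxes becomes a pair of integer
  inequalities per coordinate that characterise the quotient by N^m. So each cell lies in just one
  cell of any given coarser level.\<close>

lemma cell_subset_cell_iff:
  assumes "N \<ge> 1"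
  shows "cell N (n + m) l \<subseteq> cell N n k \<longleftrightarrow> ancestor N m l = k"
proof -
  have N: "real N > 0" "N ^ m > 0" using assms by auto
  have "cell N (n + m) l \<subseteq> cell N n k \<longleftrightarrow>
    (\<forall>j. real (k $ j) / real N ^ n \<le> real (l $ j) / real N ^ (n + m) \<and>
      (real (l $ j) + 1) / real N ^ (n + m) \<le> (real (k $ j) + 1) / real N ^ n)"
    unfolding cell_eq_cbox subset_interval_cart using N by (simp add: divide_right_mono)
  also have "\<dots> \<longleftrightarrow> (\<forall>j. k $ j * N ^ m \<le> l $ j \<and> l $ j + 1 \<le> (k $ j + 1) * N ^ m)"
  proof (intro all_cong1 conj_cong)
    fix j
    have "real (k $ j) / real N ^ n \<le> real (l $ j) / real N ^ (n + m) \<longleftrightarrow>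
      real (k $ j * N ^ m) \<le> real (l $ j)"
      using N by (simp add: power_add field_simps)
    then show "real (k $ j) / real N ^ n \<le> real (l $ j) / real N ^ (n + m) \<longleftrightarrow> k $ j * N ^ m \<le> l $ j"
      by (simp only: of_nat_le_iff)
    have "(real (l $ j) + 1) / real N ^ (n + m) = (real (l $ j) + 1) / real N ^ m / real N ^ n"
      by (simp add: power_add)
    then have "(real (l $ j) + 1) / real N ^ (n + m) \<le> (real (k $ j) + 1) / real N ^ n \<longleftrightarrow>
      real (l $ j + 1) \<le> real ((k $ j + 1) * N ^ m)"
      using N by (simp add: divide_le_cancel pos_divide_le_eq) (simp add: algebra_simps)
    then show "(real (l $ j) + 1) / real N ^ (n + m) \<le> (real (k $ j) + 1) / real N ^ n \<longleftrightarrow>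
      l $ j + 1 \<le> (k $ j + 1) * N ^ m"
      by (simp only: of_nat_le_iff)
  qed
  also have "\<dots> \<longleftrightarrow> (\<forall>j. l $ j div N ^ m = k $ j)"
  proof (intro all_cong1)
    fix j
    show "k $ j * N ^ m \<le> l $ j \<and> l $ j + 1 \<le> (k $ j + 1) * N ^ m \<longleftrightarrow> l $ j div N ^ m = k $ j"
    proof
      assume "l $ j div N ^ m = k $ j"
      then have k: "k $ j = l $ j div N ^ m" ..
      show "k $ j * N ^ m \<le> l $ j \<and> l $ j + 1 \<le> (k $ j + 1) * N ^ m"
        unfolding k using dividend_less_div_times[OF N(2), of "l $ j"] by (simp add: algebra_simps)
    qed (auto intro!: div_nat_eqI simp: algebra_simps)
  qed
  finally show ?thesis by (simp add: ancestor_def vec_eq_iff)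
qed

text \<open>The side length N^(-n) determines the level because N >= 2, and then the corner
  determines the index. Distinct pairs (n, k) therefore carry distinct marks.\<close>

lemma cell_eq_iff:
  assumes N: "N \<ge> 2"
  shows "cell N n k = cell N m l \<longleftrightarrow> n = m \<and> k = l"
proof
  have N1: "N \<ge> 1" "real N > 1" using N by auto
  have *: "n = m \<and> k = l" if eq: "cell N n k = cell N m l" and le: "n \<le> m" for n m and k l :: "nat ^ 'a"
  proof -
    obtain r where r: "m = n + r" using le_Suc_ex[OF le] by blast
    have "cbox (\<chi> j. real (k $ j) / real N ^ n) (\<chi> j. (real (k $ j) + 1) / real N ^ n) =
      cbox (\<chi> j. real (l $ j) / real N ^ m) (\<chi> j. (real (l $ j) + 1) / real N ^ m)"
      using eq by (simp add: cell_eq_cbox)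
    then have "\<forall>j. real (k $ j) / real N ^ n = real (l $ j) / real N ^ m \<and>
      (real (k $ j) + 1) / real N ^ n = (real (l $ j) + 1) / real N ^ m"
      using cell_nonempty[of N n k] by (simp add: eq_cbox cell_eq_cbox vec_eq_iff)
    then have "real (k $ j) / real N ^ n = real (l $ j) / real N ^ m"
      "(real (k $ j) + 1) / real N ^ n = (real (l $ j) + 1) / real N ^ m" for j
      by blast+
    \<comment> \<open>Subtracting the lower corner from the upper one leaves the side
      lengths.\<close>
    then have "1 / real N ^ n = 1 / real N ^ m" by (simp add: add_divide_distrib)
    then have "real N ^ n = real N ^ m" using N1 by (simp add: field_simps)
    then have "n = m" using N1 by (simp add: power_inject_exp)
    then show ?thesis using eq cell_subset_cell_iff[OF N1(1), of n 0 l k] by auto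
  qed
  assume "cell N n k = cell N m l"
  then show "n = m \<and> k = l" using *[of n k m l] *[of m l n k] by (cases "n \<le> m") auto
qed auto

section \<open>Similarities onto cells, and diameters\<close>

lemma unzoom_zoom [simp]: "N \<ge> 1 \<Longrightarrow> unzoom N n k (zoom N n k x) = x"
  by (simp add: zoom_def unzoom_def vec_eq_iff)

lemma zoom_unzoom [simp]: "N \<ge> 1 \<Longrightarrow> zoom N n k (unzoom N n k x) = x"
  by (simp add: zoom_def unzoom_def vec_eq_iff)

lemma continuous_on_zoom: "N \<ge> 1 \<Longrightarrow> continuous_on A (zoom N n k)"
  unfolding zoom_def by (intro continuous_intros) auto

lemma zoom_image_cell:
  assumes "N \<ge> 1"
  shows "zoom N n k ` cell N m l = cell N (n + m) (descendant N k m l)"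
proof -
  have N: "real N > 0" using assms by simp
  have *: "zoom N n k x \<in> cell N (n + m) (descendant N k m l) \<longleftrightarrow> x \<in> cell N m l" for x
  proof -
    have "real N ^ (n + m) * zoom N n k x $ j = real (k $ j) * real N ^ m + real N ^ m * x $ j" for j
      using N by (simp add: zoom_def power_add field_simps)
    then show ?thesis
      by (simp add: mem_cell[OF assms] descendant_def algebra_simps)
  qed
  show ?thesis
  proof (intro equalityI subsetI)
    fix y assume "y \<in> cell N (n + m) (descendant N k m l)"
    then have "unzoom N n k y \<in> cell N m l"
      using *[of "unzoom N n k y"] assms by simp
    then show "y \<in> zoom N n k ` cell N m l" using assms by (force intro: rev_image_eqI)
  qed (use * in auto)
qed

lemma inj_zoom: "N \<ge> 1 \<Longrightarrow> inj (zoom N n k)"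
  by (rule inj_on_inverseI[of _ "unzoom N n k"]) simp

lemma lipschitz_unzoom: "(real N ^ n)-lipschitz_on UNIV (unzoom N n k)"
proof (rule lipschitz_onI)
  fix x y :: "real ^ 'a"
  have "unzoom N n k x - unzoom N n k y = (real N ^ n) *\<^sub>R (x - y)"
    by (simp add: unzoom_def vec_eq_iff algebra_simps)
  then show "dist (unzoom N n k x) (unzoom N n k y) \<le> real N ^ n * dist x y"
    by (simp add: dist_norm)
qed simp

lemma dist_cell_le:
  fixes x y :: "real ^ 'd::finite"
  assumes "N \<ge> 1" "x \<in> cell N n k" "y \<in> cell N n k"
  shows "dist x y \<le> real CARD('d) / real N ^ n"
proof -
  have N: "real N > 0" using assms by simp
  have "\<bar>(x - y) $ j\<bar> \<le> 1 / real N ^ n" for j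
  proof -
    have "\<bar>real N ^ n * x $ j - real N ^ n * y $ j\<bar> \<le> 1"
      using assms(2,3)[unfolded mem_cell[OF assms(1)], rule_format, of j] by linarith
    also have "\<bar>real N ^ n * x $ j - real N ^ n * y $ j\<bar> = real N ^ n * \<bar>(x - y) $ j\<bar>"
      by (simp add: abs_mult flip: right_diff_distrib)
    finally show ?thesis using N by (simp add: field_simps)
  qed
  \<comment> \<open>The Euclidean norm is bounded by the l1 norm, which gives the constant d instead
    of the square root of d.\<close>
  then have "(\<Sum>j\<in>UNIV. \<bar>(x - y) $ j\<bar>) \<le> real CARD('d) * (1 / real N ^ n)"
    by (intro sum_bounded_above)
  then show ?thesis using norm_le_l1_cart[of "x - y"] by (simp add: dist_norm)
qed

lemma diameter_cell_le:
  fixes k :: "nat ^ 'd::finite"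
  assumes "N \<ge> 1"
  shows "diameter (cell N n k) \<le> real CARD('d) / real N ^ n"
  using dist_cell_le[OF assms] by (intro diameter_le) (auto simp: dist_norm cell_nonempty)

section \<open>Retained cubes\<close>

text \<open>Marks are required from level 1 on only, so at level 0 the single index 0 is always
  retained and the approximant is the unit cube.\<close>

definition retained_indices ::
    "nat \<Rightarrow> ((real ^ 'd::finite) set \<Rightarrow> bool) \<Rightarrow> nat \<Rightarrow> (nat ^ 'd) set" where
  "retained_indices N \<omega> n =
     {k \<in> cell_indices N n. \<forall>i\<in>{1..n}. \<omega> (cell N i (ancestor N (n - i) k))}"

definition approximant :: "nat \<Rightarrow> ((real ^ 'd::finite) set \<Rightarrow> bool) \<Rightarrow> nat \<Rightarrow> (real ^ 'd) set" where
  "approximant N \<omega> n = \<Union> (cell N n ` retained_indices N \<omega> n)"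

lemma retained_indices_subset: "retained_indices N \<omega> n \<subseteq> cell_indices N n"
  by (auto simp: retained_indices_def)

lemma finite_retained_indices: "finite (retained_indices N \<omega> n)"
  using finite_subset[OF retained_indices_subset finite_cell_indices] .

text \<open>By \<open>cell_subset_cell_iff\<close> the only cube of level m that contains a given
  smaller cell is its ancestor. Level 0 is excluded since \<open>retained\<close> would ask there
  for a mark of the unit cube.\<close>

lemma retained_eq_approximant:
  assumes N: "N \<ge> 1" and n: "n \<ge> 1"
  shows "retained N \<omega> n = approximant N \<omega> n"
proof -
  have "(\<omega> (cell N n k) \<and> (\<forall>m\<in>{1..<n}. \<forall>R\<in>level_cubes N m. cell N n k \<subseteq> R \<longrightarrow> \<omega> R)) \<longleftrightarrow>
      (\<forall>i\<in>{1..n}. \<omega> (cell N i (ancestor N (n - i) k)))" (is "?l \<longleftrightarrow> ?r")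
    if k: "k \<in> cell_indices N n" for k
  proof -
    have *: "(\<forall>R\<in>level_cubes N m. cell N n k \<subseteq> R \<longrightarrow> \<omega> R) \<longleftrightarrow> \<omega> (cell N m (ancestor N (n - m) k))"
      if m: "m \<le> n" for m
    proof -
      have "ancestor N (n - m) k \<in> cell_indices N m"
        using ancestor_in_cell_indices[of k N m "n - m"] k m by simp
      then show ?thesis
        using cell_subset_cell_iff[OF N, of m "n - m" k] m by (auto simp: level_cubes_eq)
    qed
    have "{1..n} = insert n {1..<n}" using n by auto
    then show ?thesis using * by auto
  qed
  then have "{Q \<in> level_cubes N n. \<omega> Q \<and> (\<forall>m\<in>{1..<n}. \<forall>R\<in>level_cubes N m. Q \<subseteq> R \<longrightarrow> \<omega> R)} =
      cell N n ` retained_indices N \<omega> n"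
    unfolding level_cubes_eq[of N n] retained_indices_def by blast
  then show ?thesis by (simp add: retained_def approximant_def)
qed

lemma ancestor_retained:
  assumes k: "k \<in> retained_indices N \<omega> (n + m)"
  shows "ancestor N m k \<in> retained_indices N \<omega> n"
  unfolding retained_indices_def
proof (intro CollectI conjI ballI)
  show "ancestor N m k \<in> cell_indices N n"
    using k by (intro ancestor_in_cell_indices) (auto simp: retained_indices_def)
  fix i assume i: "i \<in> {1..n}"
  then have "m + (n - i) = n + m - i" by auto
  with i k show "\<omega> (cell N i (ancestor N (n - i) (ancestor N m k)))"
    by (auto simp: retained_indices_def ancestor_ancestor)
qed

lemma approximant_antimono:
  assumes N: "N \<ge> 1" and mn: "m \<le> n"
  shows "approximant N \<omega> n \<subseteq> approximant N \<omega> m"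
proof -
  obtain r where n: "n = m + r" using le_Suc_ex[OF mn] by blast
  have "cell N n k \<subseteq> approximant N \<omega> m" if "k \<in> retained_indices N \<omega> n" for k
    using ancestor_retained[of k N \<omega> m r] that cell_subset_cell_iff[OF N, of m r k] n
    by (auto simp: approximant_def)
  then show ?thesis by (auto simp: approximant_def[of N \<omega> n])
qed

lemma limit_set_eq:
  assumes N: "N \<ge> 1"
  shows "limit_set N \<omega> = (\<Inter>n. approximant N \<omega> n)"
proof -
  have "limit_set N \<omega> = (\<Inter>n\<in>{1..}. approximant N \<omega> n)"
    unfolding limit_set_def using N by (intro INF_cong retained_eq_approximant) auto
  also have "\<dots> = (\<Inter>n. approximant N \<omega> n)"
  proof (intro equalityI subsetI INT_I)
    fix x n assume x: "x \<in> (\<Inter>n\<in>{1..}. approximant N \<omega> n)"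
    then have "x \<in> approximant N \<omega> (Suc n)" by simp
    then show "x \<in> approximant N \<omega> n" using approximant_antimono[OF N, of n "Suc n"] by auto
  qed auto
  finally show ?thesis .
qed

lemma compact_approximant: "compact (approximant N \<omega> n)"
  unfolding approximant_def using finite_retained_indices compact_cell by (intro compact_Union) auto

text \<open>The marks seen inside \<open>cell N n k\<close> after rescaling. The restriction to
  \<open>all_cubes\<close> makes the result an element of the product space, whose members are
  \<open>undefined\<close> off the index set.\<close>

definition subconfiguration ::
    "nat \<Rightarrow> nat \<Rightarrow> nat ^ 'd \<Rightarrow> ((real ^ 'd::finite) set \<Rightarrow> bool) \<Rightarrow> (real ^ 'd) set \<Rightarrow> bool" where
  "subconfiguration N n k \<omega> = (\<lambda>R\<in>all_cubes N. \<omega> (zoom N n k ` R))"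

text \<open>The chain of ancestors splits at level n: up to n it consists of ancestors of k, whose
  marks are given; beyond n it consists of rescaled ancestors of l.\<close>

lemma descendant_retained:
  assumes N: "N \<ge> 1" and k: "k \<in> retained_indices N \<omega> n"
    and l: "l \<in> retained_indices N (subconfiguration N n k \<omega>) m"
  shows "descendant N k m l \<in> retained_indices N \<omega> (n + m)"
proof -
  have kl: "k \<in> cell_indices N n" "l \<in> cell_indices N m"
    using k l by (auto simp: retained_indices_def)
  have "\<omega> (cell N i (ancestor N (n + m - i) (descendant N k m l)))" if i: "i \<in> {1..n + m}" for i
  proof (cases "i \<le> n")
    case True
    then have "n + m - i = m + (n - i)" by simp
    then have "ancestor N (n + m - i) (descendant N k m l) = ancestor N (n - i) k"
      using ancestor_descendant_ge[OF kl(2)] by simp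
    then show ?thesis using k i True by (auto simp: retained_indices_def)
  next
    case False
    define i' where "i' = i - n"
    have i': "i = n + i'" "i' \<le> m" "i' \<in> {1..m}" using False i by (auto simp: i'_def)
    have "ancestor N (m - i') l \<in> cell_indices N i'"
      using ancestor_in_cell_indices[of l N i' "m - i'"] kl i' by simp
    then have "cell N i' (ancestor N (m - i') l) \<in> all_cubes N" using i' by (auto simp: all_cubes_eq)
    moreover have "subconfiguration N n k \<omega> (cell N i' (ancestor N (m - i') l))"
      using l i' by (auto simp: retained_indices_def)
    ultimately have "\<omega> (cell N (n + i') (descendant N k i' (ancestor N (m - i') l)))"
      by (simp add: subconfiguration_def zoom_image_cell[OF N])
    then show ?thesis using i' N by (simp add: ancestor_descendant_le)
  qed
  then show ?thesis using kl by (auto simp: retained_indices_def descendant_in_cell_indices)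
qed

text \<open>Level m of the copy lands in level n + m of the whole process, which lies in level m. An
  inclusion suffices, because null sets are passed on to subsets.\<close>

lemma zoom_limit_set_subset:
  assumes N: "N \<ge> 1" and k: "k \<in> retained_indices N \<omega> n"
  shows "zoom N n k ` limit_set N (subconfiguration N n k \<omega>) \<subseteq> limit_set N \<omega>"
proof -
  have "zoom N n k ` approximant N (subconfiguration N n k \<omega>) m \<subseteq> approximant N \<omega> (n + m)" for m
    unfolding approximant_def using descendant_retained[OF N k]
    by (auto simp: zoom_image_cell[OF N] image_iff) (metis imageI zoom_image_cell[OF N])
  moreover have "approximant N \<omega> (n + m) \<subseteq> approximant N \<omega> m" for m
    using N by (intro approximant_antimono) auto
  ultimately show ?thesis by (fastforce simp: limit_set_eq[OF N])
qed

section \<open>Nontrivial components\<close>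

text \<open>Both y and z are free, so membership depends only on the component of x; the non-strict
  bound is a closed condition and survives decreasing limits.\<close>

definition large_components :: "real \<Rightarrow> 'a::metric_space set \<Rightarrow> 'a set" where
  "large_components e C =
     {x. \<exists>y z. connected_component C x y \<and> connected_component C x z \<and> e \<le> dist y z}"

lemma large_components_subset: "large_components e C \<subseteq> C"
  by (auto simp: large_components_def dest: connected_component_in)

lemma large_components_mono: "C \<subseteq> D \<Longrightarrow> large_components e C \<subseteq> large_components e D"
  unfolding large_components_def by (blast intro: connected_component_of_subset)

lemma nontrivial_components_iff:
  "x \<in> nontrivial_components C \<longleftrightarrow> (\<exists>y. connected_component C x y \<and> y \<noteq> x)"
proof
  assume "x \<in> nontrivial_components C"
  then have "connected_component C x x" "connected_component_set C x \<noteq> {x}"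
    by (auto simp: nontrivial_components_def)
  then show "\<exists>y. connected_component C x y \<and> y \<noteq> x" by auto
next
  assume "\<exists>y. connected_component C x y \<and> y \<noteq> x"
  then obtain y where y: "connected_component C x y" "y \<noteq> x" by blast
  then have "y \<in> connected_component_set C x" by simp
  with y(2) have "connected_component_set C x \<noteq> {x}" by blast
  moreover have "x \<in> C" using connected_component_in[OF y(1)] by simp
  ultimately show "x \<in> nontrivial_components C" by (simp add: nontrivial_components_def)
qed

text \<open>A component with two points has a pair at distance at least 1/(j+1) for some j. At each
  fixed scale, compactness arguments become possible.\<close>

lemma nontrivial_components_eq_UN:
  "nontrivial_components C = (\<Union>j. large_components (1 / real (Suc j)) C)"
proof (intro equalityI subsetI)
  fix x assume x: "x \<in> nontrivial_components C"
  then have "connected_component C x x" by (simp add: nontrivial_components_def)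
  moreover from x obtain y where y: "connected_component C x y" "y \<noteq> x"
    unfolding nontrivial_components_iff by blast
  moreover obtain j where "1 / real (Suc j) < dist x y"
    using nat_approx_posE[of "dist x y"] y(2) by auto
  ultimately have "x \<in> large_components (1 / real (Suc j)) C"
    unfolding large_components_def by (blast intro: less_imp_le)
  then show "x \<in> (\<Union>j. large_components (1 / real (Suc j)) C)" by blast
next
  fix x assume "x \<in> (\<Union>j. large_components (1 / real (Suc j)) C)"
  then obtain j y z where yz: "connected_component C x y" "connected_component C x z"
    "1 / real (Suc j) \<le> dist y z"
    by (auto simp: large_components_def)
  have "y \<noteq> z"
  proof
    assume "y = z"
    then have "1 / real (Suc j) \<le> 0" using yz by simp
    then show False by (simp add: divide_le_0_iff)
  qed
  with yz show "x \<in> nontrivial_components C"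
    unfolding nontrivial_components_iff by (cases "y = x") auto
qed

section \<open>Images and size of the nontrivial components\<close>

lemma nontrivial_components_image_subset:
  assumes f: "continuous_on C f" "inj_on f C" "f ` C \<subseteq> D"
  shows "f ` nontrivial_components C \<subseteq> nontrivial_components D"
proof
  fix u assume "u \<in> f ` nontrivial_components C"
  then obtain x y where x: "u = f x" and y: "connected_component C x y" "y \<noteq> x"
    by (auto simp: nontrivial_components_iff)
  then obtain K where K: "connected K" "K \<subseteq> C" "x \<in> K" "y \<in> K"
    by (auto simp: connected_component_def)
  have "connected (f ` K)" using K f continuous_on_subset by (intro connected_continuous_image) auto
  then have "connected_component D (f x) (f y)"
    using K f unfolding connected_component_def by (intro exI[of _ "f ` K"]) auto
  moreover have "f y \<noteq> f x" using f(2) K y by (auto dest: inj_onD)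
  ultimately show "u \<in> nontrivial_components D"
    unfolding x nontrivial_components_iff by blast
qed

lemma infinite_of_nontrivial_components:
  fixes C :: "'a::metric_space set"
  assumes "nontrivial_components C \<noteq> {}"
  shows "infinite C"
proof -
  from assms obtain x y where y: "connected_component C x y" "y \<noteq> x"
    by (auto simp: nontrivial_components_iff)
  then have "y \<in> connected_component_set C x" "x \<in> connected_component_set C x"
    using connected_component_in by fastforce+
  with y(2) have "connected_component_set C x \<noteq> {}" "\<nexists>a. connected_component_set C x = {a}"
    by (blast, metis singletonD)
  then have "infinite (connected_component_set C x)"
    using connected_finite_iff_sing[of "connected_component_set C x"] by blast
  then show ?thesis using connected_component_subset finite_subset by blast
qed

text \<open>The set contains an entire connected set with two points. This yields the lower bound 1
  for the dimension.\<close>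

lemma hausdorff_content_1_nontrivial_components:
  fixes C :: "'a::metric_space set"
  assumes "nontrivial_components C \<noteq> {}"
  shows "hausdorff_content 1 (nontrivial_components C) \<noteq> 0"
proof -
  from assms obtain x y where y: "connected_component C x y" "y \<noteq> x"
    by (auto simp: nontrivial_components_iff)
  then have xx: "connected_component C x x" using connected_component_in by fastforce
  have "connected_component_set C x \<subseteq> nontrivial_components C"
  proof
    fix z assume z: "z \<in> connected_component_set C x"
    then have "connected_component C z x" "connected_component C z y"
      using y(1) by (auto intro: connected_component_sym connected_component_trans)
    then show "z \<in> nontrivial_components C"
      unfolding nontrivial_components_iff using y(2) by (cases "x = z") auto
  qed
  then have "hausdorff_content 1 (connected_component_set C x) \<le>
      hausdorff_content 1 (nontrivial_components C)"
    by (rule hausdorff_content_mono)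
  moreover have "hausdorff_content 1 (connected_component_set C x) \<noteq> 0"
    using y xx by (intro hausdorff_content_1_connected[of _ x y]) auto
  ultimately show ?thesis by auto
qed

text \<open>A connected member of F that meets the set is contained in it, so the set is a finite
  union of members of F.\<close>

lemma compact_large_components_Union:
  assumes F: "finite F" "\<And>K. K \<in> F \<Longrightarrow> compact K" "\<And>K. K \<in> F \<Longrightarrow> connected K"
  shows "compact (large_components e (\<Union>F))"
proof -
  have "K \<subseteq> large_components e (\<Union>F)"
    if K: "K \<in> F" and x: "x \<in> K" "x \<in> large_components e (\<Union>F)" for K x
  proof
    fix w assume "w \<in> K"
    then have "connected_component (\<Union>F) w x"
      unfolding connected_component_def using F K x by (intro exI[of _ K]) auto
    then show "w \<in> large_components e (\<Union>F)"
      using x(2) unfolding large_components_def by (blast intro: connected_component_trans)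
  qed
  then have "large_components e (\<Union>F) = \<Union>{K \<in> F. K \<inter> large_components e (\<Union>F) \<noteq> {}}"
    using large_components_subset[of e "\<Union>F"] by fast
  moreover have "compact (\<Union>{K \<in> F. K \<inter> large_components e (\<Union>F) \<noteq> {}})"
    using F by (intro compact_Union) auto
  ultimately show ?thesis by simp
qed

text \<open>The components of a point in a decreasing sequence of compact sets decrease to a continuum,
  and pairs of points at distance at least \<open>e\<close> survive in the limit by compactness.\<close>

lemma INT_large_components_subset:
  fixes C :: "nat \<Rightarrow> 'a::euclidean_space set"
  assumes C: "\<And>n. compact (C n)" and anti: "\<And>m n. m \<le> n \<Longrightarrow> C n \<subseteq> C m"
  shows "(\<Inter>n. large_components e (C n)) \<subseteq> large_components e (\<Inter>n. C n)"
proof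
  fix x assume x: "x \<in> (\<Inter>n. large_components e (C n))"
  then have xC: "x \<in> C n" for n using large_components_subset by blast
  define K where "K n = connected_component_set (C n) x" for n
  have K: "compact (K n)" "connected (K n)" "x \<in> K n" "K n \<subseteq> C n" for n
    unfolding K_def using C[of n] xC[of n] connected_component_subset
    by (auto simp: compact_eq_bounded_closed closed_connected_component intro: bounded_subset)
  have K_anti: "K n \<subseteq> K m" if "m \<le> n" for m n
    unfolding K_def using anti[OF that] by (rule connected_component_mono)
  define P where "P n = (K n \<times> K n) \<inter> {p. e \<le> dist (fst p) (snd p)}" for n
  have "(\<Inter>n. P n) \<noteq> {}"
  proof (rule compact_nest)
    fix n
    have "closed {p::'a \<times> 'a. e \<le> dist (fst p) (snd p)}"
      by (intro closed_Collect_le continuous_intros)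
    then show "compact (P n)" unfolding P_def using K by (intro compact_Int_closed compact_Times)
    have "x \<in> large_components e (C n)" using x by blast
    then show "P n \<noteq> {}" by (auto simp: P_def K_def large_components_def)
    show "P n \<subseteq> P m" if "m \<le> n" for m using K_anti[OF that] by (auto simp: P_def)
  qed
  then obtain p where "\<And>n. p \<in> P n" by blast
  then obtain y z where yz: "\<And>n. y \<in> K n" "\<And>n. z \<in> K n" "e \<le> dist y z"
    by (cases p) (auto simp: P_def)
  have "connected (\<Inter>n. K n)" using K K_anti by (intro connected_nest) auto
  moreover have "(\<Inter>n. K n) \<subseteq> (\<Inter>n. C n)" using K by blast
  ultimately have "connected_component (\<Inter>n. C n) x y" "connected_component (\<Inter>n. C n) x z"
    using yz K(3) unfolding connected_component_def by (auto intro!: exI[of _ "\<Inter>n. K n"])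
  with yz(3) show "x \<in> large_components e (\<Inter>n. C n)" by (auto simp: large_components_def)
qed

text \<open>Otherwise the parts outside V are nonempty decreasing compact sets. A common point of
  them would belong to the large components of the limit, hence to V.\<close>

lemma large_components_eventually_subset:
  fixes C :: "nat \<Rightarrow> 'a::euclidean_space set"
  assumes C: "\<And>n. compact (C n)" "\<And>n. compact (large_components e (C n))"
    and anti: "\<And>m n. m \<le> n \<Longrightarrow> C n \<subseteq> C m"
    and V: "open V" "large_components e (\<Inter>n. C n) \<subseteq> V"
  shows "\<exists>n. large_components e (C n) \<subseteq> V"
proof (rule ccontr)
  assume not: "\<not> ?thesis"
  have "(\<Inter>n. large_components e (C n) - V) \<noteq> {}"
  proof (rule compact_nest)
    show "compact (large_components e (C n) - V)" for n using C V by (intro compact_diff)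
    show "large_components e (C n) - V \<noteq> {}" for n using not by blast
    show "large_components e (C n) - V \<subseteq> large_components e (C m) - V" if "m \<le> n" for m n
      using large_components_mono[OF anti[OF that]] by blast
  qed
  then obtain x where x: "x \<in> (\<Inter>n. large_components e (C n) - V)" by auto
  then have "x \<in> large_components e (\<Inter>n. C n)"
    by (intro subsetD[OF INT_large_components_subset[OF C(1) anti]]) auto
  then show False using V(2) x by auto
qed

text \<open>This is the key to measurability: the right-hand side combines countably many
  conditions, each on the retained cubes of one level.\<close>

lemma hausdorff_content_nontrivial_limit_set_eq_0_iff:
  fixes \<omega> :: "(real ^ 'd::finite) set \<Rightarrow> bool"
  assumes N: "N \<ge> 1" and s: "s > 0"
  shows "hausdorff_content s (nontrivial_components (limit_set N \<omega>)) = 0 \<longleftrightarrow>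
    (\<forall>j k. \<exists>n. hausdorff_content s (large_components (1 / real (Suc j)) (approximant N \<omega> n))
       < ennreal (1 / real (Suc k)))"
    (is "?l \<longleftrightarrow> ?r")
proof -
  define L where "L j = large_components (1 / real (Suc j)) (limit_set N \<omega>)" for j
  have UN: "nontrivial_components (limit_set N \<omega>) = (\<Union>j. L j)"
    unfolding L_def by (rule nontrivial_components_eq_UN)
  have "?l \<longleftrightarrow> (\<forall>j. hausdorff_content s (L j) = 0)"
  proof
    assume l: ?l
    show "\<forall>j. hausdorff_content s (L j) = 0"
    proof
      fix j
      have "hausdorff_content s (L j) \<le> hausdorff_content s (\<Union>j. L j)"
        by (rule hausdorff_content_mono) blast
      then show "hausdorff_content s (L j) = 0" using l UN by simp
    qed
  next
    assume "\<forall>j. hausdorff_content s (L j) = 0"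
    then show ?l unfolding UN by (intro hausdorff_content_UN_eq_0) simp
  qed
  also have "\<dots> \<longleftrightarrow> (\<forall>j k. hausdorff_content s (L j) < ennreal (1 / real (Suc k)))"
  proof (intro all_cong1 iffI allI)
    fix j assume less: "\<forall>k. hausdorff_content s (L j) < ennreal (1 / real (Suc k))"
    show "hausdorff_content s (L j) = 0"
    proof (rule ennreal_eq_0I)
      fix e :: real assume "e > 0"
      then obtain k where "1 / real (Suc k) < e" using nat_approx_posE by blast
      then show "hausdorff_content s (L j) \<le> ennreal e"
        using less[rule_format, of k] by (meson ennreal_leI less_imp_le order_trans)
    qed
  qed auto
  also have "\<dots> \<longleftrightarrow> ?r"
  proof (intro all_cong1)
    fix j k
    let ?e = "1 / real (Suc j)" and ?c = "ennreal (1 / real (Suc k))"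
    show "hausdorff_content s (L j) < ?c \<longleftrightarrow>
      (\<exists>n. hausdorff_content s (large_components ?e (approximant N \<omega> n)) < ?c)"
    proof
      assume "hausdorff_content s (L j) < ?c"
      \<comment> \<open>A cheap open superset of the limit object contains the object at some finite
        level; the converse direction is monotonicity.\<close>
      then obtain V where V: "L j \<subseteq> V" "open V" "hausdorff_content s V < ?c"
        using s by (rule hausdorff_content_less_open_cover)
      have "\<exists>n. large_components ?e (approximant N \<omega> n) \<subseteq> V"
      proof (rule large_components_eventually_subset)
        show "compact (large_components ?e (approximant N \<omega> n))" for n
          unfolding approximant_def
          using finite_retained_indices compact_cell connected_cell
          by (intro compact_large_components_Union) auto
      qed (use V N in \<open>auto simp: L_def limit_set_eq compact_approximant
             intro: approximant_antimono[THEN subsetD]\<close>)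
      then show "\<exists>n. hausdorff_content s (large_components ?e (approximant N \<omega> n)) < ?c"
        using V(3) hausdorff_content_mono by (meson le_less_trans)
    next
      assume "\<exists>n. hausdorff_content s (large_components ?e (approximant N \<omega> n)) < ?c"
      then obtain n where n: "hausdorff_content s (large_components ?e (approximant N \<omega> n)) < ?c" ..
      have "L j \<subseteq> large_components ?e (approximant N \<omega> n)"
        unfolding L_def limit_set_eq[OF N] by (intro large_components_mono) auto
      then show "hausdorff_content s (L j) < ?c"
        using n hausdorff_content_mono le_less_trans by blast
    qed
  qed
  finally show ?thesis .
qed

text \<open>The zoomed copy sits inside a null set, and the Lipschitz map \<open>unzoom\<close>
  carries nullness back to the original scale.\<close>

lemma hausdorff_content_nontrivial_subconfiguration:
  assumes N: "N \<ge> 1" and s: "s > 0" and k: "k \<in> retained_indices N \<omega> n"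
    and 0: "hausdorff_content s (nontrivial_components (limit_set N \<omega>)) = 0"
  shows "hausdorff_content s (nontrivial_components (limit_set N (subconfiguration N n k \<omega>))) = 0"
proof -
  let ?X = "nontrivial_components (limit_set N (subconfiguration N n k \<omega>))"
  have "zoom N n k ` ?X \<subseteq> nontrivial_components (limit_set N \<omega>)"
    using N k by (intro nontrivial_components_image_subset continuous_on_zoom
      inj_on_subset[OF inj_zoom] zoom_limit_set_subset) auto
  then have "hausdorff_content s (zoom N n k ` ?X) = 0"
    using hausdorff_content_mono[of _ _ s] 0 by (metis le_zero_eq)
  then have "hausdorff_content s (unzoom N n k ` zoom N n k ` ?X) = 0"
    using s by (rule hausdorff_content_lipschitz_eq_0[OF lipschitz_unzoom])
  then show ?thesis using N by (simp add: image_image)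
qed

text \<open>The limit set is infinite, so it contains m points; once the cells are smaller than
  their separation, these points lie in different retained cells.\<close>

lemma card_retained_indices_at_top:
  fixes \<omega> :: "(real ^ 'd::finite) set \<Rightarrow> bool"
  assumes N: "N \<ge> 2" and C: "nontrivial_components (limit_set N \<omega>) \<noteq> {}"
  shows "\<forall>\<^sub>F n in sequentially. m \<le> card (retained_indices N \<omega> n)"
proof -
  obtain X where X: "X \<subseteq> limit_set N \<omega>" "card X = m" "finite X"
    using infinite_arbitrarily_large[OF infinite_of_nontrivial_components[OF C]] by metis
  have "\<exists>d>0. \<forall>y\<in>X. y \<noteq> x \<longrightarrow> d \<le> dist x y" for x
    using finite_set_avoid[OF X(3)] by metis
  then obtain d where d: "\<And>x. d x > 0" "\<And>x y. y \<in> X \<Longrightarrow> y \<noteq> x \<Longrightarrow> d x \<le> dist x y" by metis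
  \<comment> \<open>A lower bound for all mutual distances in X; the element 1 keeps the minimum
    defined when X is empty, that is for m = 0.\<close>
  define D where "D = Min (insert 1 (d ` X))"
  have D: "D > 0" "\<And>x. x \<in> X \<Longrightarrow> D \<le> d x" using X d(1) by (auto simp: D_def)
  have "(\<lambda>n. real CARD('d) / real N ^ n) \<longlonglongrightarrow> 0"
    using N by (intro LIMSEQ_divide_realpow_zero) simp
  then have "\<forall>\<^sub>F n in sequentially. real CARD('d) / real N ^ n < D"
    using D(1) by (rule order_tendstoD)
  then show ?thesis
  proof eventually_elim
    case (elim n)
    have "\<exists>k\<in>retained_indices N \<omega> n. x \<in> cell N n k" if "x \<in> X" for x
      using that X(1) N limit_set_eq[of N \<omega>] by (auto simp: approximant_def)
    then obtain f where f: "\<And>x. x \<in> X \<Longrightarrow> f x \<in> retained_indices N \<omega> n" "\<And>x. x \<in> X \<Longrightarrow> x \<in> cell N n (f x)"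
      by metis
    have "inj_on f X"
    proof (rule inj_onI, rule ccontr)
      fix x y assume xy: "x \<in> X" "y \<in> X" "f x = f y" "x \<noteq> y"
      then have "dist x y \<le> real CARD('d) / real N ^ n"
        using f(2)[of x] f(2)[of y] N by (intro dist_cell_le[of N x n "f x"]) auto
      then show False using d(2)[of y x] D(2)[of x] xy elim by auto
    qed
    then show ?case
      using card_inj_on_le[of f X "retained_indices N \<omega> n", OF _ _ finite_retained_indices] f X(2)
      by auto
  qed
qed

text \<open>At most N^(nd) cells of diameter at most d N^(-n) cover the limit set, at cost at most
  N^(n(d-s)) d^s, which tends to 0.\<close>

lemma hausdorff_content_limit_set_eq_0:
  fixes \<omega> :: "(real ^ 'd::finite) set \<Rightarrow> bool"
  assumes N: "N \<ge> 2" and s: "s > real CARD('d)"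
  shows "hausdorff_content s (limit_set N \<omega>) = 0"
proof -
  define D where "D = real CARD('d)"
  have D: "D > 0" by (simp add: D_def)
  have N': "real N > 1" using N by simp
  define g where "g n = (real N powr (D - s)) ^ n * D powr s" for n
  have "hausdorff_content s (limit_set N \<omega>) \<le> ennreal (g n)" for n
  proof -
    let ?F = "cell N n ` (cell_indices N n :: (nat ^ 'd) set)"
    have "limit_set N \<omega> \<subseteq> approximant N \<omega> n" using N by (auto simp: limit_set_eq)
    also have "\<dots> \<subseteq> \<Union>?F"
      unfolding approximant_def using retained_indices_subset by (intro Union_mono image_mono)
    finally have "hausdorff_content s (limit_set N \<omega>) \<le> (\<Sum>U\<in>?F. diam_pow s U)"
      using s by (intro hausdorff_content_le_finite)
        (auto intro: compact_imp_bounded compact_cell finite_cell_indices)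
    also have "\<dots> \<le> (\<Sum>U\<in>?F. ennreal ((D / real N ^ n) powr s))"
    proof (intro sum_mono)
      fix U assume "U \<in> ?F"
      then obtain k where "U = cell N n k" by auto
      then have "diameter U powr s \<le> (D / real N ^ n) powr s"
        using diameter_cell_le[of N n k] N s unfolding D_def
        by (intro powr_mono2) (auto simp: diameter_ge_0 compact_imp_bounded compact_cell)
      then show "diam_pow s U \<le> ennreal ((D / real N ^ n) powr s)"
        using s D by (simp add: diam_pow_pos ennreal_leI D_def)
    qed
    also have "\<dots> = ennreal (real (card ?F) * (D / real N ^ n) powr s)"
      by (simp add: ennreal_mult ennreal_of_nat_eq_real_of_nat)
    also have "\<dots> \<le> ennreal (g n)"
    proof (rule ennreal_leI)
      have "card ?F \<le> (N ^ n) ^ CARD('d)"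
        using card_image_le[OF finite_cell_indices] card_cell_indices le_trans by blast
      then have "real (card ?F) \<le> (real N ^ n) ^ CARD('d)"
        by (metis of_nat_le_iff of_nat_power)
      also have "\<dots> = (real N ^ n) powr D" using N' by (simp add: D_def powr_realpow)
      finally have "real (card ?F) * (D / real N ^ n) powr s \<le> (real N ^ n) powr D * (D / real N ^ n) powr s"
        by (intro mult_right_mono) auto
      also have "\<dots> = (real N ^ n) powr (D - s) * D powr s"
        using N' D by (simp add: powr_divide powr_diff)
      also have "(real N ^ n) powr (D - s) = (real N powr (D - s)) ^ n"
        using N' by (simp add: powr_powr mult.commute flip: powr_realpow)
      finally show "real (card ?F) * (D / real N ^ n) powr s \<le> g n" by (simp add: g_def)
    qed
    finally show ?thesis .
  qed
  moreover have "(\<lambda>n. ennreal (g n)) \<longlonglongrightarrow> ennreal 0"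
  proof (rule tendsto_ennrealI)
    have "real N powr (D - s) < 1" using s N' by (simp add: D_def powr_less_one)
    then have "(\<lambda>n. (real N powr (D - s)) ^ n) \<longlonglongrightarrow> 0" by (intro LIMSEQ_realpow_zero) auto
    then show "g \<longlonglongrightarrow> 0" unfolding g_def by (rule tendsto_mult_left_zero)
  qed
  ultimately have "hausdorff_content s (limit_set N \<omega>) \<le> ennreal 0"
    by (intro tendsto_lowerbound[of _ _ sequentially]) auto
  then show ?thesis by simp
qed

section \<open>Measurability and independence\<close>

definition low_cubes :: "nat \<Rightarrow> nat \<Rightarrow> (real ^ 'd::finite) set set" where
  "low_cubes N n = (\<Union>i\<in>{1..n}. cell N i ` cell_indices N i)"

text \<open>Since \<open>all_cubes\<close> starts at level 1, \<open>cell N n k\<close> itself is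
  not included, which keeps this block of marks apart from \<open>low_cubes N n\<close>.\<close>

definition subcubes :: "nat \<Rightarrow> nat \<Rightarrow> nat ^ 'd \<Rightarrow> (real ^ 'd::finite) set set" where
  "subcubes N n k = (\<lambda>R. zoom N n k ` R) ` all_cubes N"

abbreviation marks :: "real \<Rightarrow> (real ^ 'd::finite) set set \<Rightarrow> ((real ^ 'd) set \<Rightarrow> bool) measure" where
  "marks p I \<equiv> PiM I (\<lambda>_. measure_pmf (bernoulli_pmf p))"

lemma percolation_measure_eq_marks: "percolation_measure N p = marks p (all_cubes N)"
  by (simp add: percolation_measure_def)

lemma prob_space_percolation_measure: "prob_space (percolation_measure N p)"
  unfolding percolation_measure_def by (intro prob_space_PiM measure_pmf.prob_space_axioms)

lemma low_cubes_subset: "low_cubes N n \<subseteq> all_cubes N"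
  by (auto simp: low_cubes_def all_cubes_eq)

section \<open>Disjoint blocks of marks\<close>

lemma subcubesE:
  assumes "R \<in> subcubes N n k" and "N \<ge> 1"
  obtains m l where "m \<ge> 1" "l \<in> cell_indices N m" "R = cell N (n + m) (descendant N k m l)"
proof -
  obtain m l where R: "R = zoom N n k ` cell N m l" "m \<ge> 1" "l \<in> cell_indices N m"
    using assms by (auto simp: subcubes_def all_cubes_eq)
  show thesis by (rule that[OF R(2,3)]) (simp add: R(1) zoom_image_cell[OF assms(2)])
qed

lemma subcubes_subset:
  assumes "N \<ge> 1" "k \<in> cell_indices N n"
  shows "subcubes N n k \<subseteq> all_cubes N"
proof
  fix R assume "R \<in> subcubes N n k"
  then obtain m l where R: "m \<ge> 1" "l \<in> cell_indices N m" "R = cell N (n + m) (descendant N k m l)"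
    using assms(1) by (rule subcubesE)
  have "descendant N k m l \<in> cell_indices N (n + m)"
    using assms R by (intro descendant_in_cell_indices)
  then show "R \<in> all_cubes N"
    using R by (auto simp: all_cubes_eq intro!: bexI[of _ "n + m"])
qed

lemma low_cubes_disjoint_subcubes:
  assumes N: "N \<ge> 2"
  shows "low_cubes N n \<inter> subcubes N n k = {}"
proof (rule equals0I)
  fix R assume R: "R \<in> low_cubes N n \<inter> subcubes N n k"
  then obtain i a where "i \<le> n" "R = cell N i a" by (auto simp: low_cubes_def)
  moreover from R N obtain m l where "m \<ge> 1" "R = cell N (n + m) (descendant N k m l)"
    by (auto elim: subcubesE)
  ultimately show False using N by (simp add: cell_eq_iff)
qed

text \<open>The index k is recovered from any cell of the block as its ancestor at level n.\<close>

lemma subcubes_disjoint: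
  assumes N: "N \<ge> 2" and k: "k \<noteq> k'"
  shows "subcubes N n k \<inter> subcubes N n k' = {}"
proof (rule equals0I)
  fix R assume R: "R \<in> subcubes N n k \<inter> subcubes N n k'"
  have N1: "N \<ge> 1" using N by simp
  from R obtain m l where l: "l \<in> cell_indices N m" "R = cell N (n + m) (descendant N k m l)"
    using subcubesE[OF _ N1] by blast
  from R obtain m' l' where l': "l' \<in> cell_indices N m'" "R = cell N (n + m') (descendant N k' m' l')"
    using subcubesE[OF _ N1] by blast
  have "m = m'" "descendant N k m l = descendant N k' m' l'"
    using l l' N by (auto simp: cell_eq_iff)
  then have "k = k'"
    using ancestor_descendant[OF l(1), of k] ancestor_descendant[OF l'(1), of k'] by simp
  with k show False ..
qed

section \<open>Measurability of the null event\<close>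

lemma pred_mark:
  assumes "Q \<in> I"
  shows "Measurable.pred (marks p I) (\<lambda>\<omega>. \<omega> Q)"
proof -
  have "(\<lambda>\<omega>. \<omega> Q) \<in> marks p I \<rightarrow>\<^sub>M measure_pmf (bernoulli_pmf p)"
    using assms by (rule measurable_component_singleton)
  then show ?thesis by (simp cong: measurable_cong_sets)
qed

lemma ancestor_cell_in_low_cubes:
  assumes "k \<in> cell_indices N n" "i \<in> {1..n}"
  shows "cell N i (ancestor N (n - i) k) \<in> low_cubes N n"
proof -
  have "ancestor N (n - i) k \<in> cell_indices N i"
    using assms ancestor_in_cell_indices[of k N i "n - i"] by simp
  then show ?thesis using assms by (auto simp: low_cubes_def)
qed

text \<open>The predicate \<Phi> may be arbitrary: the set of retained indices has finitely many
  possible values, and each is taken on an event given by finitely many marks.\<close>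

lemma pred_retained_indices:
  assumes I: "low_cubes N n \<subseteq> I"
  shows "Measurable.pred (marks p I) (\<lambda>\<omega>. \<Phi> (retained_indices N \<omega> n))"
proof -
  let ?K = "cell_indices N n :: (nat ^ 'a) set"
  have "Measurable.pred (marks p I) (\<lambda>\<omega>. \<omega> (cell N i (ancestor N (n - i) k)))"
    if "k \<in> ?K" "i \<in> {1..n}" for k i
    using ancestor_cell_in_low_cubes[OF that] I by (intro pred_mark) auto
  then have *: "Measurable.pred (marks p I)
      (\<lambda>\<omega>. \<forall>k\<in>?K. k \<in> Z \<longleftrightarrow> (\<forall>i\<in>{1..n}. \<omega> (cell N i (ancestor N (n - i) k))))" for Z
    by (intro pred_intros_finite finite_cell_indices pred_intros_logic) auto
  have "Measurable.pred (marks p I)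
      (\<lambda>\<omega>. \<exists>Z\<in>Pow ?K. \<Phi> Z \<and> (\<forall>k\<in>?K. k \<in> Z \<longleftrightarrow> (\<forall>i\<in>{1..n}. \<omega> (cell N i (ancestor N (n - i) k)))))"
    by (intro pred_intros_finite finite_Pow_iff[THEN iffD2] finite_cell_indices pred_intros_logic *) auto
  also have "(\<lambda>\<omega>. \<exists>Z\<in>Pow ?K. \<Phi> Z \<and> (\<forall>k\<in>?K. k \<in> Z \<longleftrightarrow> (\<forall>i\<in>{1..n}. \<omega> (cell N i (ancestor N (n - i) k))))) =
      (\<lambda>\<omega>. \<Phi> (retained_indices N \<omega> n))"
  proof (intro ext iffI)
    fix \<omega> assume "\<exists>Z\<in>Pow ?K. \<Phi> Z \<and> (\<forall>k\<in>?K. k \<in> Z \<longleftrightarrow> (\<forall>i\<in>{1..n}. \<omega> (cell N i (ancestor N (n - i) k))))"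
    then obtain Z where Z: "Z \<subseteq> ?K" "\<Phi> Z"
      "\<forall>k\<in>?K. k \<in> Z \<longleftrightarrow> (\<forall>i\<in>{1..n}. \<omega> (cell N i (ancestor N (n - i) k)))" by auto
    have "Z = retained_indices N \<omega> n"
      unfolding retained_indices_def using Z(1,3) by (intro set_eqI) blast
    then show "\<Phi> (retained_indices N \<omega> n)" using Z(2) by simp
  next
    fix \<omega> assume "\<Phi> (retained_indices N \<omega> n)"
    then show "\<exists>Z\<in>Pow ?K. \<Phi> Z \<and> (\<forall>k\<in>?K. k \<in> Z \<longleftrightarrow> (\<forall>i\<in>{1..n}. \<omega> (cell N i (ancestor N (n - i) k))))"
      by (intro bexI[of _ "retained_indices N \<omega> n"]) (auto simp: retained_indices_def)
  qed
  finally show ?thesis .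
qed

lemma pred_null_nontrivial_components:
  assumes "N \<ge> 1" "s > 0"
  shows "Measurable.pred (percolation_measure N p)
    (\<lambda>\<omega>. hausdorff_content s (nontrivial_components (limit_set N \<omega>)) = 0)"
  unfolding hausdorff_content_nontrivial_limit_set_eq_0_iff[OF assms] percolation_measure_eq_marks
    approximant_def
  using pred_retained_indices[OF low_cubes_subset] by (intro pred_intros_countable)

section \<open>Law and independence of the rescaled copies\<close>

lemma retained_indices_restrict: "retained_indices N (restrict \<omega> (low_cubes N n)) n = retained_indices N \<omega> n"
  by (auto simp: retained_indices_def ancestor_cell_in_low_cubes)

lemma subconfiguration_restrict:
  "subconfiguration N n k (restrict \<omega> (subcubes N n k)) = subconfiguration N n k \<omega>"
  by (auto simp: subconfiguration_def subcubes_def restrict_def)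

lemma measurable_subconfiguration:
  assumes "subcubes N n k \<subseteq> I"
  shows "subconfiguration N n k \<in> marks p I \<rightarrow>\<^sub>M percolation_measure N p"
  unfolding subconfiguration_def percolation_measure_eq_marks
  using assms by (intro measurable_restrict measurable_component_singleton) (auto simp: subcubes_def)

text \<open>Statistical self-similarity: reading independent identically distributed marks along an
  injection of the index set does not change their law.\<close>

lemma distr_subconfiguration:
  assumes N: "N \<ge> 1" and k: "k \<in> cell_indices N n"
  shows "distr (percolation_measure N p) (percolation_measure N p) (subconfiguration N n k) =
    percolation_measure N p"
  unfolding subconfiguration_def percolation_measure_eq_marks
proof (rule distr_PiM_reindex)
  show "inj_on (\<lambda>R. zoom N n k ` R) (all_cubes N)"
    using inj_zoom[OF N, of n k] by (intro inj_onI) (simp add: inj_image_eq_iff)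
  show "(\<lambda>R. zoom N n k ` R) \<in> all_cubes N \<rightarrow> all_cubes N"
    using subcubes_subset[OF N k] by (auto simp: subcubes_def)
qed (rule measure_pmf.prob_space_axioms)

text \<open>Independence amounts to the joint law being the product of the marginals, and the joint
  law of all coordinates is the product measure itself.\<close>

lemma indep_marks:
  fixes p :: real and I :: "(real ^ 'd::finite) set set"
  assumes "I \<noteq> {}"
  shows "prob_space.indep_vars (marks p I) (\<lambda>_. measure_pmf (bernoulli_pmf p)) (\<lambda>Q \<omega>. \<omega> Q) I"
proof -
  let ?B = "measure_pmf (bernoulli_pmf p)"
  interpret prob_space "marks p I"
    by (intro prob_space_PiM measure_pmf.prob_space_axioms)
  have "distr (marks p I) (marks p I) (\<lambda>\<omega>. restrict \<omega> I) = distr (marks p I) (marks p I) (\<lambda>\<omega>. \<omega>)"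
    by (intro distr_cong) (auto simp: space_PiM)
  also have "\<dots> = marks p I" by (rule distr_id)
  also have "\<dots> = PiM I (\<lambda>Q. distr (marks p I) ?B (\<lambda>\<omega>. \<omega> Q))"
    by (intro PiM_cong refl distr_PiM_component[symmetric] measure_pmf.prob_space_axioms)
  finally show ?thesis
    using assms by (subst indep_vars_iff_distr_eq_PiM') (auto intro: measurable_component_singleton)
qed

text \<open>The event G passes to the copy in each cell of Z. These copies have the law of the whole
  process, and they depend on disjoint blocks of marks, also disjoint from the block deciding which
  cells are retained.\<close>

lemma prob_retained_and_null_le:
  fixes N :: nat and p :: real and s :: real
  defines "M \<equiv> percolation_measure N p :: ((real ^ 'd::finite) set \<Rightarrow> bool) measure"
  defines "G \<equiv> \<lambda>\<omega> :: (real ^ 'd) set \<Rightarrow> bool.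
    hausdorff_content s (nontrivial_components (limit_set N \<omega>)) = 0"
  assumes N: "N \<ge> 2" and s: "s > 0" and Z: "Z \<subseteq> cell_indices N n"
  shows "measure M {\<omega> \<in> space M. retained_indices N \<omega> n = Z \<and> G \<omega>} \<le>
    measure M {\<omega> \<in> space M. retained_indices N \<omega> n = Z} * measure M {\<omega> \<in> space M. G \<omega>} ^ card Z"
proof -
  interpret prob_space M unfolding M_def by (rule prob_space_percolation_measure)
  have N1: "N \<ge> 1" using N by simp
  have M: "M = marks p (all_cubes N)" by (simp add: M_def percolation_measure_eq_marks)
  have finZ: "finite Z" using Z finite_cell_indices by (rule finite_subset)
  \<comment> \<open>The blocks are indexed by an option type: \<open>None\<close> stands for the
    levels up to n, \<open>Some k\<close> for the interior of cell k.\<close>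
  define K where "K (j :: (nat ^ 'd) option) = (case j of None \<Rightarrow> low_cubes N n | Some k \<Rightarrow> subcubes N n k)" for j
  define L where "L = insert None (Some ` Z)"
  define A where "A j = (case j of None \<Rightarrow> {\<omega> \<in> space (marks p (K None)). retained_indices N \<omega> n = Z}
    | Some k \<Rightarrow> {\<omega> \<in> space (marks p (K (Some k))). G (subconfiguration N n k \<omega>)})" for j
  define X where "X j \<omega> = restrict \<omega> (K j)" for j and \<omega> :: "(real ^ 'd) set \<Rightarrow> bool"
  have K: "K j \<subseteq> all_cubes N" if "j \<in> L" for j
  proof (cases j)
    case (Some k)
    then have "k \<in> cell_indices N n" using that Z by (auto simp: L_def)
    then show ?thesis using Some by (simp add: K_def subcubes_subset[OF N1])
  qed (simp add: K_def low_cubes_subset)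
  have disj: "disjoint_family_on K L"
    using low_cubes_disjoint_subcubes[OF N] subcubes_disjoint[OF N]
    by (fastforce simp: disjoint_family_on_def K_def L_def)
  have "(cell N 1 0 :: (real ^ 'd) set) \<in> all_cubes N"
    using N by (auto simp: all_cubes_eq cell_indices_def intro!: bexI[of _ 1])
  then have "indep_vars (\<lambda>_. measure_pmf (bernoulli_pmf p)) (\<lambda>Q \<omega>. \<omega> Q) (all_cubes N)"
    unfolding M by (intro indep_marks) auto
  then have indep: "indep_vars (\<lambda>j. marks p (K j)) X L"
    unfolding X_def[abs_def] using K disj by (rule indep_vars_restrict)
  have predG: "Measurable.pred M G"
    unfolding M_def G_def using N1 s by (rule pred_null_nontrivial_components)
  have A: "A j \<in> sets (marks p (K j))" if "j \<in> L" for j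
  proof (cases j)
    case None
    have "Measurable.pred (marks p (K None)) (\<lambda>\<omega>. retained_indices N \<omega> n = Z)"
      by (rule pred_retained_indices) (simp add: K_def)
    then show ?thesis by (simp add: None A_def pred_def)
  next
    case (Some k)
    have "subconfiguration N n k \<in> marks p (K (Some k)) \<rightarrow>\<^sub>M M"
      unfolding M_def by (rule measurable_subconfiguration) (simp add: K_def)
    then have "Measurable.pred (marks p (K (Some k))) (\<lambda>\<omega>. G (subconfiguration N n k \<omega>))"
      using predG by (rule measurable_compose)
    then show ?thesis by (simp add: Some A_def pred_def)
  qed
  \<comment> \<open>The events depend only on the marks of their own block, so restricting the
    configuration first changes nothing.\<close>
  have XA: "X j -` A j \<inter> space M = (case j of None \<Rightarrow> {\<omega> \<in> space M. retained_indices N \<omega> n = Z}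
      | Some k \<Rightarrow> {\<omega> \<in> space M. G (subconfiguration N n k \<omega>)})" if "j \<in> L" for j
  proof -
    have "X j \<omega> \<in> space (marks p (K j))" if "\<omega> \<in> space M" for \<omega>
      by (auto simp: X_def space_PiM)
    then show ?thesis
      by (auto simp: A_def X_def K_def retained_indices_restrict subconfiguration_restrict split: option.split)
  qed
  have probG: "prob {\<omega> \<in> space M. G (subconfiguration N n k \<omega>)} = prob {\<omega> \<in> space M. G \<omega>}"
    if "k \<in> Z" for k
  proof -
    have k: "k \<in> cell_indices N n" using that Z by auto
    have T: "subconfiguration N n k \<in> M \<rightarrow>\<^sub>M M"
      unfolding M M_def[symmetric] using measurable_subconfiguration[OF subcubes_subset[OF N1 k]]
      by (simp add: M_def percolation_measure_eq_marks)
    have "prob {\<omega> \<in> space M. G \<omega>} = measure (distr M M (subconfiguration N n k)) {\<omega> \<in> space M. G \<omega>}"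
      unfolding M_def distr_subconfiguration[OF N1 k] ..
    also have "\<dots> = prob (subconfiguration N n k -` {\<omega> \<in> space M. G \<omega>} \<inter> space M)"
      using predG by (intro measure_distr T) (simp add: pred_def)
    also have "subconfiguration N n k -` {\<omega> \<in> space M. G \<omega>} \<inter> space M =
        {\<omega> \<in> space M. G (subconfiguration N n k \<omega>)}"
      using measurable_space[OF T] by auto
    finally show ?thesis ..
  qed
  have "prob {\<omega> \<in> space M. retained_indices N \<omega> n = Z \<and> G \<omega>} \<le> prob (\<Inter>j\<in>L. X j -` A j \<inter> space M)"
  proof (rule finite_measure_mono)
    show "{\<omega> \<in> space M. retained_indices N \<omega> n = Z \<and> G \<omega>} \<subseteq> (\<Inter>j\<in>L. X j -` A j \<inter> space M)"
    proof (intro subsetI INT_I)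
      fix \<omega> j assume \<omega>: "\<omega> \<in> {\<omega> \<in> space M. retained_indices N \<omega> n = Z \<and> G \<omega>}" and j: "j \<in> L"
      have "G (subconfiguration N n k \<omega>)" if "k \<in> Z" for k
        using \<omega> that hausdorff_content_nontrivial_subconfiguration[OF N1 s, of k \<omega> n]
        by (auto simp: G_def)
      then show "\<omega> \<in> X j -` A j \<inter> space M"
        unfolding XA[OF j] using j \<omega> by (auto simp: L_def split: option.split)
    qed
    show "(\<Inter>j\<in>L. X j -` A j \<inter> space M) \<in> events"
    proof (rule sets.finite_INT)
      show "X j -` A j \<inter> space M \<in> events" if "j \<in> L" for j
        using indep that A[OF that] by (intro measurable_sets) (auto simp: indep_vars_def)
    qed (use finZ in \<open>auto simp: L_def\<close>)
  qed
  also have "\<dots> = (\<Prod>j\<in>L. prob (X j -` A j \<inter> space M))"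
    using finZ A by (intro indep_varsD[OF indep]) (auto simp: L_def)
  also have "\<dots> = (\<Prod>j\<in>L. case j of None \<Rightarrow> prob {\<omega> \<in> space M. retained_indices N \<omega> n = Z}
      | Some k \<Rightarrow> prob {\<omega> \<in> space M. G \<omega>})"
    using XA probG by (intro prod.cong refl) (auto simp: L_def)
  also have "\<dots> = prob {\<omega> \<in> space M. retained_indices N \<omega> n = Z} * prob {\<omega> \<in> space M. G \<omega>} ^ card Z"
    using finZ by (simp add: L_def prod.reindex)
  finally show ?thesis .
qed

text \<open>The event is split by the exact set Z of retained indices. Each Z has at least m
  elements, the base of the power is at most 1, and the disjoint events for Z have total probability
  at most 1.\<close>

lemma prob_many_retained_and_null_le:
  fixes N :: nat and p :: real and s :: real
  defines "M \<equiv> percolation_measure N p :: ((real ^ 'd::finite) set \<Rightarrow> bool) measure"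
  defines "G \<equiv> \<lambda>\<omega> :: (real ^ 'd) set \<Rightarrow> bool.
    hausdorff_content s (nontrivial_components (limit_set N \<omega>)) = 0"
  assumes N: "N \<ge> 2" and s: "s > 0"
  shows "measure M {\<omega> \<in> space M. m \<le> card (retained_indices N \<omega> n) \<and> G \<omega>} \<le>
    measure M {\<omega> \<in> space M. G \<omega>} ^ m"
proof -
  interpret prob_space M unfolding M_def by (rule prob_space_percolation_measure)
  have predG: "Measurable.pred M G"
    unfolding M_def G_def using N s by (intro pred_null_nontrivial_components) auto
  have pred: "Measurable.pred M (\<lambda>\<omega>. retained_indices N \<omega> n = Z)" for Z
    unfolding M_def percolation_measure_eq_marks by (rule pred_retained_indices[OF low_cubes_subset])
  define S where "S = {Z. Z \<subseteq> (cell_indices N n :: (nat ^ 'd) set) \<and> m \<le> card Z}"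
  have finS: "finite S" by (simp add: S_def finite_cell_indices)
  let ?g = "prob {\<omega> \<in> space M. G \<omega>}"
  let ?E = "\<lambda>Z. {\<omega> \<in> space M. retained_indices N \<omega> n = Z}"
  have "{\<omega> \<in> space M. m \<le> card (retained_indices N \<omega> n) \<and> G \<omega>} =
      (\<Union>Z\<in>S. {\<omega> \<in> space M. retained_indices N \<omega> n = Z \<and> G \<omega>})"
    using retained_indices_subset[of N _ n, where ?'a = 'd] by (auto simp: S_def)
  then have "prob {\<omega> \<in> space M. m \<le> card (retained_indices N \<omega> n) \<and> G \<omega>} \<le>
      (\<Sum>Z\<in>S. prob {\<omega> \<in> space M. retained_indices N \<omega> n = Z \<and> G \<omega>})"
    using finS pred predG
    by (auto intro!: finite_measure_subadditive_finite simp: pred_def[symmetric])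
  also have "\<dots> \<le> (\<Sum>Z\<in>S. prob (?E Z) * ?g ^ m)"
  proof (intro sum_mono)
    fix Z assume Z: "Z \<in> S"
    have "prob {\<omega> \<in> space M. retained_indices N \<omega> n = Z \<and> G \<omega>} \<le> prob (?E Z) * ?g ^ card Z"
      unfolding M_def G_def using N s Z by (intro prob_retained_and_null_le) (auto simp: S_def)
    also have "\<dots> \<le> prob (?E Z) * ?g ^ m"
      using Z by (intro mult_left_mono power_decreasing) (auto simp: S_def)
    finally show "prob {\<omega> \<in> space M. retained_indices N \<omega> n = Z \<and> G \<omega>} \<le> prob (?E Z) * ?g ^ m" .
  qed
  also have "\<dots> = prob (\<Union>Z\<in>S. ?E Z) * ?g ^ m"
    using finS pred unfolding sum_distrib_right[symmetric]
    by (subst finite_measure_finite_Union) (auto simp: disjoint_family_on_def pred_def)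
  also have "\<dots> \<le> 1 * ?g ^ m" by (intro mult_right_mono) auto
  finally show ?thesis by simp
qed

section \<open>The zero-one law\<close>

text \<open>If G has probability g < 1, then G together with unboundedly many retained cells has
  probability at most g^m for every m, hence 0.\<close>

lemma null_nontrivial_components_zero_one:
  fixes N :: nat and p :: real and s :: real
  defines "M \<equiv> percolation_measure N p :: ((real ^ 'd::finite) set \<Rightarrow> bool) measure"
  defines "G \<equiv> \<lambda>\<omega> :: (real ^ 'd) set \<Rightarrow> bool.
    hausdorff_content s (nontrivial_components (limit_set N \<omega>)) = 0"
  assumes N: "N \<ge> 2" and s: "s > 0"
  shows "(AE \<omega> in M. G \<omega>) \<or> (AE \<omega> in M. nontrivial_components (limit_set N \<omega>) = {} \<or> \<not> G \<omega>)"
proof -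
  interpret prob_space M unfolding M_def by (rule prob_space_percolation_measure)
  have predG: "Measurable.pred M G"
    unfolding M_def G_def using N s by (intro pred_null_nontrivial_components) auto
  define g where "g = prob {\<omega> \<in> space M. G \<omega>}"
  show ?thesis
  proof (cases "g = 1")
    case True
    then have "AE \<omega> in M. \<omega> \<in> {\<omega> \<in> space M. G \<omega>}" unfolding g_def by (rule AE_prob_1)
    then show ?thesis by auto
  next
    case False
    then have g: "0 \<le> g" "g < 1"
      using prob_le_1[of "{\<omega> \<in> space M. G \<omega>}"] by (auto simp: g_def less_le)
    \<comment> \<open>Demanding m cells at all levels from k on makes B m k increasing in k, so the
      bound g^m carries over to the union.\<close>
    define B where "B m k = {\<omega> \<in> space M. G \<omega> \<and> (\<forall>n\<ge>k. m \<le> card (retained_indices N \<omega> n))}" for m k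
    have pred: "Measurable.pred M (\<lambda>\<omega>. m \<le> card (retained_indices N \<omega> n))" for m n
      unfolding M_def percolation_measure_eq_marks by (rule pred_retained_indices[OF low_cubes_subset])
    have B: "B m k \<in> events" for m k
    proof -
      have "Measurable.pred M (\<lambda>\<omega>. G \<omega> \<and> (\<forall>n. k \<le> n \<longrightarrow> m \<le> card (retained_indices N \<omega> n)))"
        using predG pred by (intro pred_intros_logic pred_intros_countable) auto
      then show ?thesis by (simp add: B_def pred_def)
    qed
    have le: "prob (B m k) \<le> g ^ m" for m k
    proof -
      have "prob (B m k) \<le> prob {\<omega> \<in> space M. m \<le> card (retained_indices N \<omega> k) \<and> G \<omega>}"
        using predG pred by (intro finite_measure_mono) (auto simp: B_def pred_def[symmetric])
      also have "\<dots> \<le> g ^ m"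
        unfolding g_def M_def G_def using N s by (rule prob_many_retained_and_null_le)
      finally show ?thesis .
    qed
    have "(\<lambda>k. prob (B m k)) \<longlonglongrightarrow> prob (\<Union>k. B m k)" for m
      using B by (intro finite_Lim_measure_incseq) (auto simp: incseq_def B_def)
    then have UB: "prob (\<Union>k. B m k) \<le> g ^ m" for m
      by (rule LIMSEQ_le_const2) (simp add: le)
    have "prob (\<Inter>m. \<Union>k. B m k) \<le> g ^ m" for m
      using B by (intro order_trans[OF finite_measure_mono UB]) auto
    moreover have "(\<lambda>m. g ^ m) \<longlonglongrightarrow> 0" using g by (intro LIMSEQ_realpow_zero)
    ultimately have "prob (\<Inter>m. \<Union>k. B m k) \<le> 0"
      by (intro LIMSEQ_le_const[of "\<lambda>m. g ^ m"]) auto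
    then have "prob (\<Inter>m. \<Union>k. B m k) = 0" by (simp add: measure_le_0_iff)
    moreover have "(\<Inter>m. \<Union>k. B m k) \<in> events" using B by auto
    ultimately have "AE \<omega> in M. \<omega> \<notin> (\<Inter>m. \<Union>k. B m k)" by (simp add: prob_eq_0)
    then have "AE \<omega> in M. nontrivial_components (limit_set N \<omega>) = {} \<or> \<not> G \<omega>"
    proof (rule AE_mp, intro AE_I2 impI)
      fix \<omega> assume \<omega>: "\<omega> \<in> space M" "\<omega> \<notin> (\<Inter>m. \<Union>k. B m k)"
      then obtain m where m: "\<And>k. \<omega> \<notin> B m k" by auto
      show "nontrivial_components (limit_set N \<omega>) = {} \<or> \<not> G \<omega>"
      proof (rule ccontr)
        assume "\<not> ?thesis"
        then have *: "nontrivial_components (limit_set N \<omega>) \<noteq> {}" "G \<omega>" by auto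
        obtain k where "\<forall>n\<ge>k. m \<le> card (retained_indices N \<omega> n)"
          using card_retained_indices_at_top[OF N *(1), of m] by (auto simp: eventually_sequentially)
        then show False using m[of k] \<omega>(1) * by (auto simp: B_def)
      qed
    qed
    then show ?thesis by simp
  qed
qed

text \<open>Rational exponents suffice by monotonicity in the exponent, so that only countably many
  almost sure statements have to be combined.\<close>

lemma hausdorff_dim_eqI:
  fixes A :: "'a::metric_space set"
  assumes b: "b \<ge> 0"
    and null: "\<And>q. q \<in> \<rat> \<Longrightarrow> q > b \<Longrightarrow> hausdorff_measure q A = 0"
    and pos: "\<And>q. q \<in> \<rat> \<Longrightarrow> 0 \<le> q \<Longrightarrow> q < b \<Longrightarrow> hausdorff_measure q A \<noteq> 0"
  shows "hausdorff_dim A = ereal b"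
  unfolding hausdorff_dim_def
proof (rule antisym)
  show "Inf (ereal ` {s. 0 \<le> s \<and> hausdorff_measure s A = 0}) \<le> ereal b"
  proof (rule ereal_le_epsilon2)
    fix e :: real assume "0 < e"
    then obtain q where q: "q \<in> \<rat>" "b < q" "q < b + e" using Rats_dense_in_real[of b "b + e"] by auto
    then have "Inf (ereal ` {s. 0 \<le> s \<and> hausdorff_measure s A = 0}) \<le> ereal q"
      using null b by (intro Inf_lower) auto
    then show "Inf (ereal ` {s. 0 \<le> s \<and> hausdorff_measure s A = 0}) \<le> ereal b + ereal e"
      using q by (simp add: order_trans)
  qed
  show "ereal b \<le> Inf (ereal ` {s. 0 \<le> s \<and> hausdorff_measure s A = 0})"
  proof (rule Inf_greatest)
    fix x assume "x \<in> ereal ` {s. 0 \<le> s \<and> hausdorff_measure s A = 0}"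
    then obtain s where s: "x = ereal s" "0 \<le> s" "hausdorff_measure s A = 0" by auto
    have "b \<le> s"
    proof (rule ccontr)
      assume "\<not> b \<le> s"
      then obtain q where "q \<in> \<rat>" "s < q" "q < b" using Rats_dense_in_real[of s b] by auto
      then show False using pos[of q] hausdorff_measure_eq_0_mono[OF s(3,2)] s(2) by auto
    qed
    then show "ereal b \<le> x" using s by simp
  qed
qed

theorem theorem1p2:
  fixes N :: nat and p :: real
  assumes "CARD('d::finite) \<ge> 2" and "N \<ge> 2" and "0 \<le> p" and "p \<le> 1"
  shows "\<exists>\<beta>::real. 1 \<le> \<beta> \<and> \<beta> \<le> real CARD('d) \<and>
    (AE \<omega> in (percolation_measure N p :: ((real ^ 'd) set \<Rightarrow> bool) measure).
       nontrivial_components (limit_set N \<omega>) = {} \<or>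
       hausdorff_dim (nontrivial_components (limit_set N \<omega>)) = ereal \<beta>)"
proof -
  let ?M = "percolation_measure N p :: ((real ^ 'd) set \<Rightarrow> bool) measure"
  let ?C = "\<lambda>\<omega> :: (real ^ 'd) set \<Rightarrow> bool. nontrivial_components (limit_set N \<omega>)"
  \<comment> \<open>Exponents below 1 are left out, which gives \<beta> >= 1 at once; they are
    treated separately by the connectedness bound.\<close>
  define S where "S = {s. 1 \<le> s \<and> (AE \<omega> in ?M. hausdorff_measure s (?C \<omega>) = 0)}"
  have large: "s \<in> S" if s: "s > real CARD('d)" for s
  proof -
    have "hausdorff_measure s (?C \<omega>) = 0" for \<omega>
    proof -
      have "?C \<omega> \<subseteq> limit_set N \<omega>" by (auto simp: nontrivial_components_def)
      then have "hausdorff_content s (?C \<omega>) = 0"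
        using hausdorff_content_mono[of "?C \<omega>" "limit_set N \<omega>" s]
          hausdorff_content_limit_set_eq_0[OF assms(2) s] by simp
      then show ?thesis using s by (simp add: hausdorff_measure_eq_0_iff)
    qed
    then show ?thesis using s assms(1) by (simp add: S_def)
  qed
  define \<beta> where "\<beta> = Inf S"
  have bdd: "bdd_below S" by (rule bdd_belowI[of _ 1]) (simp add: S_def)
  have ne: "S \<noteq> {}" using large[of "real CARD('d) + 1"] by auto
  have \<beta>1: "1 \<le> \<beta>" unfolding \<beta>_def using ne by (intro cInf_greatest) (auto simp: S_def)
  \<comment> \<open>Every number above d belongs to S, so the infimum is at most d.\<close>
  have \<beta>d: "\<beta> \<le> real CARD('d)"
    by (rule dense_ge) (auto simp: \<beta>_def intro!: cInf_lower large bdd)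
  have above: "AE \<omega> in ?M. hausdorff_measure q (?C \<omega>) = 0" if "q > \<beta>" for q
  proof -
    have "Inf S < q" using that by (simp add: \<beta>_def)
    then obtain s where s: "s \<in> S" "s < q" using cInf_lessD[OF ne] by blast
    then have "AE \<omega> in ?M. hausdorff_measure s (?C \<omega>) = 0" by (simp add: S_def)
    then show ?thesis
    proof (rule AE_mp, intro AE_I2 impI)
      fix \<omega> assume "hausdorff_measure s (?C \<omega>) = 0"
      then show "hausdorff_measure q (?C \<omega>) = 0"
        using s by (intro hausdorff_measure_eq_0_mono[of s _ q]) (auto simp: S_def)
    qed
  qed
  \<comment> \<open>For q < 1 nullness would pass to exponent 1, against connectedness. For q >= 1,
    q is not in S, which excludes the first alternative of the zero-one law.\<close>
  have below: "AE \<omega> in ?M. ?C \<omega> = {} \<or> hausdorff_measure q (?C \<omega>) \<noteq> 0" if "0 \<le> q" "q < \<beta>" for q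
  proof (cases "q < 1")
    case True
    have "hausdorff_measure q (?C \<omega>) \<noteq> 0" if "?C \<omega> \<noteq> {}" for \<omega>
    proof
      assume "hausdorff_measure q (?C \<omega>) = 0"
      then have "hausdorff_measure 1 (?C \<omega>) = 0"
        using \<open>0 \<le> q\<close> True by (rule hausdorff_measure_eq_0_mono)
      then show False
        using hausdorff_content_1_nontrivial_components[OF that]
        by (simp add: hausdorff_measure_eq_0_iff)
    qed
    then show ?thesis by (intro AE_I2) blast
  next
    case False
    then have q: "q > 0" by simp
    have "q \<notin> S" using that(2) cInf_lower[OF _ bdd] by (force simp: \<beta>_def)
    then have "\<not> (AE \<omega> in ?M. hausdorff_measure q (?C \<omega>) = 0)" using False by (simp add: S_def)
    then show ?thesis
      using null_nontrivial_components_zero_one[OF assms(2) q, where 'd='d and p=p]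
      unfolding hausdorff_measure_eq_0_iff[OF q] by blast
  qed
  \<comment> \<open>One exceptional null set serves all rational exponents simultaneously.\<close>
  have "AE \<omega> in ?M. \<forall>q\<in>\<rat>. (q > \<beta> \<longrightarrow> hausdorff_measure q (?C \<omega>) = 0) \<and>
      (0 \<le> q \<and> q < \<beta> \<longrightarrow> ?C \<omega> = {} \<or> hausdorff_measure q (?C \<omega>) \<noteq> 0)"
  proof (intro AE_ball_countable[THEN iffD2] countable_rat ballI)
    fix q :: real
    show "AE \<omega> in ?M. (q > \<beta> \<longrightarrow> hausdorff_measure q (?C \<omega>) = 0) \<and>
      (0 \<le> q \<and> q < \<beta> \<longrightarrow> ?C \<omega> = {} \<or> hausdorff_measure q (?C \<omega>) \<noteq> 0)"
      using above[of q] below[of q] by (cases "q > \<beta>"; cases "0 \<le> q \<and> q < \<beta>") auto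
  qed
  then have "AE \<omega> in ?M. ?C \<omega> = {} \<or> hausdorff_dim (?C \<omega>) = ereal \<beta>"
  proof (rule AE_mp, intro AE_I2 impI)
    fix \<omega>
    assume *: "\<forall>q\<in>\<rat>. (q > \<beta> \<longrightarrow> hausdorff_measure q (?C \<omega>) = 0) \<and>
      (0 \<le> q \<and> q < \<beta> \<longrightarrow> ?C \<omega> = {} \<or> hausdorff_measure q (?C \<omega>) \<noteq> 0)"
    show "?C \<omega> = {} \<or> hausdorff_dim (?C \<omega>) = ereal \<beta>"
    proof (cases "?C \<omega> = {}")
      case False
      then have "hausdorff_dim (?C \<omega>) = ereal \<beta>"
        using * \<beta>1 by (intro hausdorff_dim_eqI) auto
      then show ?thesis ..
    qed simp
  qed
  with \<beta>1 \<beta>d show ?thesis by blast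
qed

end
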